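(* Let $0<t<1$ and let $\rho_n$ be the density of eigenvalues for the potential $V(z)=|z|^2-\mathrm{Re}(tz^2)$. Let $z_0=a_t\cos\phi+i\,b_t\sin\phi$ be a point on the ellipse $\partial E_t$ with $\phi\in(-\pi,\pi]$, and let $\psi$ be the angle between the real axis and the outward normal to the tangent at $\partial E_t$ in $z_0$, i.e. $$\psi=\begin{cases}\arctan\left(\frac{1+t}{1-t}\tan\phi\right)&\text{if }\phi\in(-\frac\pi2,\frac\pi2),\\ \arctan\left(\frac{1+t}{1-t}\tan\phi\right)+\mathrm{sign}(\phi)\pi&\text{if }\phi\notin[-\frac\pi2,\frac\pi2],\\ \phi&\text{if }\phi=\pm\frac\pi2.\end{cases}$$ Then for every $a\in\mathbb C$ $$\lim_{n\to\infty}\rho_n\left(z_0+\frac{a\,e^{i\psi}}{\sqrt n}\right)=\frac1{2\pi}\,\mathrm{erfc}\left(\sqrt2\,\mathrm{Re}\,a\right).$$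
   Context: For $n\in\mathbb N$, let $(p_{k,n})_{k\ge0}$ be the polynomials with $\deg p_{k,n}=k$ and positive leading coefficient satisfying $\int_{\mathbb C}\overline{p_{k,n}(z)}p_{l,n}(z)e^{-nV(z)}\,d^2z=\delta_{kl}$ ($d^2z$ is Lebesgue measure). The density of eigenvalues is $\rho_n(z)=\frac1n e^{-nV(z)}\sum_{k=0}^{n-1}|p_{k,n}(z)|^2$. Let $a_t=\sqrt{\frac{1+t}{1-t}}$, $b_t=\sqrt{\frac{1-t}{1+t}}$ and $\partial E_t=\{z\in\mathbb C:\frac{(\mathrm{Re}\,z)^2}{a_t^2}+\frac{(\mathrm{Im}\,z)^2}{b_t^2}=1\}$. $\mathrm{erfc}(z)=\frac{2}{\sqrt\pi}\int_z^\infty e^{-w^2}dw$. *)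

theory Defs
  imports "HOL-Analysis.Analysis" "HOL-Computational_Algebra.Polynomial"
begin

(* The diagonal case k = l (value 1, hence nonzero) forces |p k|^2 exp (- n V) to be integrable,
   and then the off-diagonal integrands are integrable too (for measurable V) by Cauchy-Schwarz.
   So the convention that the integral of a non-integrable function is 0 plays no role. *)
definition is_orthonormal_polys :: "(complex \<Rightarrow> real) \<Rightarrow> nat \<Rightarrow> (nat \<Rightarrow> complex poly) \<Rightarrow> bool"
  where "is_orthonormal_polys V n p \<longleftrightarrow>
    (\<forall>k. degree (p k) = k \<and> lead_coeff (p k) \<in> \<real> \<and> 0 < Re (lead_coeff (p k))) \<and>
    (\<forall>k l. (\<integral>z. cnj (poly (p k) z) * poly (p l) z * of_real (exp (- real n * V z)) \<partial>lborel)
             = (if k = l then 1 else 0))"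

(* The normalisation makes such a family unique when it exists, so the definite description
   is determined as soon as n > 0 and V grows fast enough at infinity.
   For n = 0 the weight is constant and no family exists. *)
definition orthonormal_polys :: "(complex \<Rightarrow> real) \<Rightarrow> nat \<Rightarrow> nat \<Rightarrow> complex poly"
  where "orthonormal_polys V n = (THE p. is_orthonormal_polys V n p)"

definition eigenvalue_density :: "(complex \<Rightarrow> real) \<Rightarrow> nat \<Rightarrow> complex \<Rightarrow> real"
  where "eigenvalue_density V n z =
    1 / real n * exp (- real n * V z) * (\<Sum>k<n. (cmod (poly (orthonormal_polys V n k) z))\<^sup>2)"

definition elliptic_potential :: "real \<Rightarrow> complex \<Rightarrow> real"
  where "elliptic_potential t z = (cmod z)\<^sup>2 - Re (of_real t * z\<^sup>2)"

definition semi_axis_re :: "real \<Rightarrow> real"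
  where "semi_axis_re t = sqrt ((1 + t) / (1 - t))"

definition semi_axis_im :: "real \<Rightarrow> real"
  where "semi_axis_im t = sqrt ((1 - t) / (1 + t))"

definition ellipse_boundary :: "real \<Rightarrow> complex set"
  where "ellipse_boundary t =
    {z. (Re z)\<^sup>2 / (semi_axis_re t)\<^sup>2 + (Im z)\<^sup>2 / (semi_axis_im t)\<^sup>2 = 1}"

(* Angle between the real axis and the outward normal of the ellipse at the point with
   parameter phi in {-pi<..pi}. *)
definition normal_angle :: "real \<Rightarrow> real \<Rightarrow> real"
  where "normal_angle t \<phi> =
    (if \<phi> \<in> {- pi / 2 <..< pi / 2} then arctan ((1 + t) / (1 - t) * tan \<phi>)
     else if \<phi> \<notin> {- pi / 2 .. pi / 2} then arctan ((1 + t) / (1 - t) * tan \<phi>) + sgn \<phi> * pi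
     else \<phi>)"

definition erfc :: "real \<Rightarrow> real"
  where "erfc x = 2 / sqrt pi * (LINT w:{x..}|lborel. exp (- w\<^sup>2))"

end

theory Submission
  imports Defs "HOL-Probability.Probability" "HOL-Complex_Analysis.Complex_Analysis"
    "HOL-Real_Asymp.Real_Asymp"
begin

text \<open>
  The density is read as a probability. In the plane, integration by parts against the Gaussian
  weight identifies the orthonormal polynomials as rescaled Hermite polynomials, and Mehler's
  formula sums \<open>\<Sum>\<^sub>k |p\<^sub>k(z)|\<^sup>2 s\<^sup>k\<close> in closed form for \<open>|s| \<le> 1\<close>. At \<open>s = 1\<close> the full sum
  times the weight is \<open>n / \<pi>\<close> for every \<open>z\<close>, so \<open>\<rho>\<^sub>n(z) = P(X < n) / \<pi>\<close>, where \<open>X\<close> is a random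
  variable on the natural numbers with an explicit generating function. A second-order expansion
  of its characteristic function at \<open>z\<^sub>0 + a e\<^sup>i\<^sup>\<psi> / \<surd>n\<close> shows that \<open>(X - n) / (\<sigma> \<surd>n)\<close> converges
  weakly to a normal law with mean \<open>2 Re a\<close> and variance \<open>1\<close> (Levy's continuity theorem), where
  \<open>\<sigma>\<close> is the length of the normal vector \<open>(cos \<phi> / a\<^sub>t, sin \<phi> / b\<^sub>t)\<close> of the ellipse.
\<close>

text \<open>The obstacle is the cut-off: the sum truncated at \<open>n\<close> has no usable closed
  form, while the full sum does. Near \<open>s = 1\<close> the logarithm of the generating function
  is, up to a bounded term, \<open>n * (s - 1) * h(s)\<close> with
  \<open>h(s) = x^2 (1-t)/(1+t s) + y^2 (1+t)/(1-t s)\<close>. So X has mean about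
  \<open>n * h(1)\<close>, and \<open>h(1) = x^2/a_t^2 + y^2/b_t^2\<close>: the ellipse is exactly
  where the mean meets the cut-off. Moving the point by order \<open>1/sqrt n\<close> moves the mean
  by order \<open>sqrt n\<close>, the size of the standard deviation, which explains the scale. To
  that order only the gradient of \<open>h(1)\<close> in (x, y) is felt, hence only Re a. On the
  ellipse the variance is about \<open>n * (1 + 2 h'(1))\<close>, and this equals \<open>n\<close>
  times the squared length of the normal vector (half that gradient); the two lengths cancel, so t
  and the position on the ellipse drop out of the limit. Since t < 1, the singularities at
  \<open>s = 1/t\<close> and \<open>s = -1/t\<close> stay outside the closed unit disc, so the
  closed form is valid on the whole unit circle, where the characteristic function lives.\<close>

unbundle no vec_syntax

section \<open>Hermite polynomials and Mehler's formula\<close>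

text \<open>For c nonzero this is \<open>c^(k/2) He_k(z / sqrt c)\<close> with \<open>He_k\<close>
  the probabilists' Hermite polynomial. Keeping c as a parameter avoids the square root, and the
  form \<open>z - c d/dz\<close> is the raising operator that later becomes the adjoint of
  differentiation.\<close>

primrec herm :: "complex \<Rightarrow> nat \<Rightarrow> complex poly" where
  "herm c 0 = 1"
| "herm c (Suc k) = [:0, 1:] * herm c k - smult c (pderiv (herm c k))"

text \<open>The Appell property. It turns the definition into a three-term recurrence, and later
  yields the factor \<open>k + 1\<close> between consecutive squared norms.\<close>

lemma pderiv_herm_Suc: "pderiv (herm c (Suc k)) = smult (of_nat (Suc k)) (herm c k)"
proof (induction k)
  case 0
  show ?case by (simp add: pderiv_pCons)
next
  case (Suc k)
  have "pderiv (herm c (Suc (Suc k))) =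
      pderiv ([:0, 1:] * herm c (Suc k)) - smult c (pderiv (pderiv (herm c (Suc k))))"
    by (simp only: herm.simps(2)[of c "Suc k"] pderiv_diff pderiv_smult)
  also have "\<dots> = herm c (Suc k) + [:0, 1:] * smult (of_nat (Suc k)) (herm c k)
      - smult c (smult (of_nat (Suc k)) (pderiv (herm c k)))"
    by (simp only: pderiv_mult Suc.IH pderiv_smult) (simp add: pderiv_pCons)
  also have "\<dots> = herm c (Suc k) + smult (of_nat (Suc k)) (herm c (Suc k))"
    by (simp only: herm.simps(2)[of c k] smult_diff_right mult_smult_right)
       (simp add: algebra_simps)
  also have "\<dots> = smult (of_nat (Suc (Suc k))) (herm c (Suc k))"
    by (simp only: of_nat_Suc[of "Suc k"] smult_add_left smult_1_left)
  finally show ?case .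
qed

lemma poly_herm_Suc_Suc:
  "poly (herm c (Suc (Suc k))) z =
     z * poly (herm c (Suc k)) z - c * of_nat (Suc k) * poly (herm c k) z"
  by (simp only: herm.simps(2)[of c "Suc k"] pderiv_herm_Suc) simp

lemma degree_herm: "degree (herm c k) = k"
  and lead_coeff_herm: "lead_coeff (herm c k) = 1"
proof -
  have "degree (herm c k) = k \<and> coeff (herm c k) k = 1"
  proof (induction k)
    case 0
    show ?case by simp
  next
    case (Suc k)
    have ne: "herm c k \<noteq> 0" using Suc by auto
    have 1: "degree ([:0, 1:] * herm c k) = Suc k"
      using ne Suc by (simp add: degree_pCons_eq)
    have "degree (smult c (pderiv (herm c k))) \<le> k"
      using Suc by (metis degree_pderiv degree_smult_le diff_le_self order_trans)
    hence 2: "degree (smult c (pderiv (herm c k))) < Suc k" by simp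
    have "degree (herm c (Suc k)) = Suc k"
      unfolding herm.simps using degree_add_eq_left[of "- smult c (pderiv (herm c k))"] 1 2 by simp
    moreover have "coeff (herm c (Suc k)) (Suc k) = 1"
      using Suc coeff_eq_0[OF 2] by simp
    ultimately show ?case by simp
  qed
  thus "degree (herm c k) = k" "lead_coeff (herm c k) = 1" by auto
qed

text \<open>Real c gives real coefficients. This is what lets \<open>|P_k(z)|^2\<close> be written
  as \<open>P_k(z) P_k(cnj z)\<close>, the diagonal case of Mehler's formula. The recurrence reaches
  back two indices, so the induction carries a pair.\<close>

lemma cnj_poly_herm: "cnj (poly (herm (of_real c) k) z) = poly (herm (of_real c) k) (cnj z)"
proof -
  have "cnj (poly (herm (of_real c) k) z) = poly (herm (of_real c) k) (cnj z) \<and>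
        cnj (poly (herm (of_real c) (Suc k)) z) = poly (herm (of_real c) (Suc k)) (cnj z)"
  proof (induction k)
    case (Suc k)
    thus ?case by (simp only: poly_herm_Suc_Suc complex_cnj_mult complex_cnj_diff) simp
  qed (simp add: pderiv_1)
  thus ?thesis by blast
qed

definition mehler_fps :: "complex \<Rightarrow> complex \<Rightarrow> complex \<Rightarrow> complex fps" where
  "mehler_fps c z w = Abs_fps (\<lambda>k. poly (herm c k) z * poly (herm c k) w / fact k)"

text \<open>
  The three-term recurrence relates the series of \<open>P\<^sub>k(z) P\<^sub>k(w)\<close>, \<open>P\<^sub>k\<^sub>+\<^sub>1(z) P\<^sub>k(w)\<close> and
  \<open>P\<^sub>k(z) P\<^sub>k\<^sub>+\<^sub>1(w)\<close> linearly; eliminating the last two leaves a first-order ODE for the first.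
\<close>
lemma mehler_fps_ode:
  fixes c z w :: complex
  defines "D \<equiv> 1 - fps_const (c\<^sup>2) * fps_X\<^sup>2"
  shows "D\<^sup>2 * fps_deriv (mehler_fps c z w) =
    ((fps_const z - fps_const (c * w) * fps_X) * (fps_const w - fps_const (c * z) * fps_X)
      + fps_const (c\<^sup>2) * fps_X * D) * mehler_fps c z w"
proof -
  define h where "h = (\<lambda>k. poly (herm c k))"
  have h0: "h 0 u = 1" "h (Suc 0) u = u" for u by (simp_all add: h_def pderiv_1)
  have h2: "h (Suc (Suc k)) u = u * h (Suc k) u - c * of_nat (Suc k) * h k u" for k u
    by (simp add: h_def poly_herm_Suc_Suc del: herm.simps)
  define A where "A = Abs_fps (\<lambda>k. h k z * h k w / fact k)"
  define B where "B = Abs_fps (\<lambda>k. h (Suc k) z * h k w / fact k)"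
  define E where "E = Abs_fps (\<lambda>k. h k z * h (Suc k) w / fact k)"
  \<comment> \<open>\<open>G\<close> appears when the recurrence in z is applied to the coefficients
    of \<open>fps_deriv A\<close>; the recurrence in w then removes it again.\<close>
  define G where "G = Abs_fps (\<lambda>k. h k z * h (Suc (Suc k)) w / fact k)"
  let ?c = "fps_const c" and ?z = "fps_const z" and ?w = "fps_const w"
  \<comment> \<open>At \<open>k = 0\<close> truncated subtraction turns \<open>f (k - 1)\<close>
    into \<open>f 0\<close>, but the factor \<open>of_nat k\<close> vanishes there.\<close>
  have X_mult: "(fps_X * Abs_fps (\<lambda>k. f k / fact k)) $ k = of_nat k * f (k - 1) / fact k"
    for f :: "nat \<Rightarrow> complex" and k
    by (cases k) (simp_all add: divide_simps del: of_nat_Suc)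
  have const_X: "(fps_X * (fps_const c * F)) $ k = c * (fps_X * F) $ k" for F :: "complex fps" and k
    by (simp add: mult.left_commute[of fps_X] del: fps_X_mult_nth)
  have deriv_A: "fps_deriv A $ k = h (Suc k) z * h (Suc k) w / fact k" for k
    by (simp add: A_def divide_simps del: of_nat_Suc)
  have X_deriv: "(fps_X * fps_deriv A) $ k = of_nat k * h k z * h k w / fact k" for k
    by (cases k) (simp_all add: A_def)
  have B: "B = ?z * A - ?c * (fps_X * E)"
  proof (rule fps_ext)
    fix k show "B $ k = (?z * A - ?c * (fps_X * E)) $ k"
      unfolding A_def B_def E_def
      by (cases k) (simp_all add: h0 h2 const_X X_mult divide_simps algebra_simps del: of_nat_Suc fact_Suc fps_X_mult_nth)
  qed
  have E: "E = ?w * A - ?c * (fps_X * B)"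
  proof (rule fps_ext)
    fix k show "E $ k = (?w * A - ?c * (fps_X * B)) $ k"
      unfolding A_def B_def E_def
      by (cases k) (simp_all add: h0 h2 const_X X_mult divide_simps algebra_simps del: of_nat_Suc fact_Suc fps_X_mult_nth)
  qed
  have A': "fps_deriv A = ?z * E - ?c * (fps_X * G)"
  proof (rule fps_ext)
    fix k show "fps_deriv A $ k = (?z * E - ?c * (fps_X * G)) $ k"
      unfolding deriv_A E_def G_def
      by (cases k) (simp_all add: h0 h2 const_X X_mult divide_simps algebra_simps del: of_nat_Suc fact_Suc fps_X_mult_nth)
  qed
  have G: "G = ?w * E - ?c * (A + fps_X * fps_deriv A)"
  proof (rule fps_ext)
    fix k show "G $ k = (?w * E - ?c * (A + fps_X * fps_deriv A)) $ k"
      by (simp add: const_X X_deriv del: fps_X_mult_nth)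
         (simp add: A_def E_def G_def h2 divide_simps, simp add: algebra_simps)
  qed
  have D: "D = 1 - ?c\<^sup>2 * fps_X\<^sup>2" by (simp add: D_def fps_const_power)
  have DE: "D * E = (?w - ?c * ?z * fps_X) * A"
    using B E unfolding D by algebra
  have DA: "D * fps_deriv A = (?z - ?c * ?w * fps_X) * E + ?c\<^sup>2 * fps_X * A"
    using A' G unfolding D by algebra
  have "D\<^sup>2 * fps_deriv A =
     ((?z - ?c * ?w * fps_X) * (?w - ?c * ?z * fps_X) + ?c\<^sup>2 * fps_X * D) * A"
    using DE DA by algebra
  thus ?thesis
    by (simp add: A_def h_def mehler_fps_def fps_const_power)
qed

text \<open>The quotient of two solutions has derivative zero: \<open>F\<close> is invertible
  because its constant term is 1, and \<open>P * F\<close> can be cancelled because formal power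
  series over a field form an integral domain.\<close>

lemma fps_linear_ode_unique:
  fixes F G P Q :: "complex fps"
  assumes "P \<noteq> 0" and F: "P * fps_deriv F = Q * F" and G: "P * fps_deriv G = Q * G"
    and "F $ 0 = 1" "G $ 0 = 1"
  shows "F = G"
proof -
  define H where "H = G * inverse F"
  have GF: "G = F * H"
    using assms(4) by (simp add: H_def inverse_mult_eq_1' mult.left_commute)
  have "P * (F * fps_deriv H) = 0"
    using G F unfolding GF fps_deriv_mult by algebra
  moreover have "F \<noteq> 0" using assms(4) by auto
  ultimately have "fps_deriv H = 0" using \<open>P \<noteq> 0\<close> by simp
  hence "H = fps_const (H $ 0)" by (simp add: fps_deriv_eq_0_iff)
  moreover have "H $ 0 = 1" using GF assms(4,5) by auto
  ultimately show ?thesis using GF by simp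
qed

text \<open>The closed form satisfies, as a function of r, the ODE already proved for the formal
  series, and both start at 1. So the series is its Taylor expansion, and holomorphy on the disc
  \<open>norm (c * r) < 1\<close> gives convergence there.\<close>

lemma mehler_sums:
  fixes c z w r :: complex
  assumes r: "norm (c * r) < 1"
  shows "(\<lambda>k. poly (herm c k) z * poly (herm c k) w / fact k * r ^ k) sums
    (exp ((r * z * w - c * r\<^sup>2 * (z\<^sup>2 + w\<^sup>2) / 2) / (1 - (c * r)\<^sup>2)) / csqrt (1 - (c * r)\<^sup>2))"
proof -
  define f where "f = (\<lambda>r. exp ((r * z * w - c * r\<^sup>2 * (z\<^sup>2 + w\<^sup>2) / 2) / (1 - (c * r)\<^sup>2))
    / csqrt (1 - (c * r)\<^sup>2))"
  define S where "S = {r. norm (c * r) < 1}"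
  \<comment> \<open>A positive real part keeps the argument off the branch cut of
    \<open>csqrt\<close>, so the principal root is holomorphic on all of \<open>S\<close>.\<close>
  have pos: "Re (1 - (c * r)\<^sup>2) > 0" if "r \<in> S" for r
  proof -
    have "norm ((c * r)\<^sup>2) < 1"
      using that by (simp add: S_def norm_power power_less_one_iff del: norm_mult)
    thus ?thesis using complex_Re_le_cmod[of "(c * r)\<^sup>2"] by simp
  qed
  have nz: "1 - (c * r)\<^sup>2 \<noteq> 0" and nonpos: "1 - (c * r)\<^sup>2 \<notin> \<real>\<^sub>\<le>\<^sub>0" if "r \<in> S" for r
    using pos[OF that] by (auto simp: complex_nonpos_Reals_iff simp del: Re_complex_of_real)
  have oS: "open S" unfolding S_def by (intro open_Collect_less continuous_intros)
  \<comment> \<open>The derivative is arranged to be the analytic counterpart of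
    \<open>mehler_fps_ode\<close>, solved for the derivative.\<close>
  have deriv: "(f has_field_derivative
      (((z - c * w * r) * (w - c * z * r) + c\<^sup>2 * r * (1 - (c * r)\<^sup>2)) / (1 - (c * r)\<^sup>2)\<^sup>2 * f r)) (at r)"
    if "r \<in> S" for r
  proof -
    define d where "d = 1 - (c * r)\<^sup>2"
    define s where "s = csqrt d"
    have s2: "s\<^sup>2 = d" and d0: "d \<noteq> 0" using nz[OF that] by (auto simp: s_def d_def)
    hence s0: "s \<noteq> 0" by auto
    define N where "N = r * z * w - c * r\<^sup>2 * (z\<^sup>2 + w\<^sup>2) / 2"
    have N: "((\<lambda>r. r * z * w - c * r\<^sup>2 * (z\<^sup>2 + w\<^sup>2) / 2) has_field_derivative
        (z * w - c * r * (z\<^sup>2 + w\<^sup>2))) (at r)"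
      by (auto intro!: derivative_eq_intros)
    have d: "((\<lambda>r. 1 - (c * r)\<^sup>2) has_field_derivative (- 2 * c\<^sup>2 * r)) (at r)"
      by (auto intro!: derivative_eq_intros simp: power2_eq_square)
    have "((\<lambda>r. csqrt (1 - (c * r)\<^sup>2)) has_field_derivative inverse (2 * s) * (- 2 * c\<^sup>2 * r)) (at r)"
      unfolding s_def d_def by (rule DERIV_chain2[OF has_field_derivative_csqrt[OF nonpos[OF that]] d])
    with DERIV_chain2[OF DERIV_exp DERIV_divide[OF N d nz[OF that]]]
    have "(f has_field_derivative
       (exp (N / d) * (((z * w - c * r * (z\<^sup>2 + w\<^sup>2)) * d - N * (- 2 * c\<^sup>2 * r)) / (d * d)) * s
         - exp (N / d) * (inverse (2 * s) * (- 2 * c\<^sup>2 * r))) / (s * s)) (at r)"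
      unfolding f_def N_def d_def s_def by (rule DERIV_divide) (use nz[OF that] in auto)
    also have "exp (N / d) = f r * s"
      using s0 by (simp add: f_def N_def d_def s_def)
    also have "(f r * s * (((z * w - c * r * (z\<^sup>2 + w\<^sup>2)) * d - N * (- 2 * c\<^sup>2 * r)) / (d * d)) * s
         - f r * s * (inverse (2 * s) * (- 2 * c\<^sup>2 * r))) / (s * s) =
       (((z * w - c * r * (z\<^sup>2 + w\<^sup>2)) * d + N * (2 * c\<^sup>2 * r)) / d\<^sup>2 + c\<^sup>2 * r / d) * f r"
      using d0 s0 unfolding s2[symmetric] by (simp add: field_simps power2_eq_square)
    also have "((z * w - c * r * (z\<^sup>2 + w\<^sup>2)) * d + N * (2 * c\<^sup>2 * r)) / d\<^sup>2 + c\<^sup>2 * r / d =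
       ((z - c * w * r) * (w - c * z * r) + c\<^sup>2 * r * d) / d\<^sup>2"
    proof -
      have "(z * w - c * r * (z\<^sup>2 + w\<^sup>2)) * d + N * (2 * c\<^sup>2 * r) =
          (z - c * w * r) * (w - c * z * r)"
        by (simp add: N_def d_def field_simps power2_eq_square)
      thus ?thesis using d0 by (simp add: field_simps power2_eq_square)
    qed
    finally show ?thesis by (simp add: d_def)
  qed
  hence holo: "f holomorphic_on S"
    using oS holomorphic_on_open by blast
  have "0 \<in> S" by (simp add: S_def)
  have exp: "f has_fps_expansion fps_expansion f 0"
    by (rule has_fps_expansion_fps_expansion[OF oS \<open>0 \<in> S\<close> holo])
  define D where "D = 1 - fps_const (c\<^sup>2) * fps_X\<^sup>2"
  define Q where "Q = (fps_const z - fps_const (c * w) * fps_X) * (fps_const w - fps_const (c * z) * fps_X)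
      + fps_const (c\<^sup>2) * fps_X * D"
  have L: "(\<lambda>r. (1 - c\<^sup>2 * r\<^sup>2)\<^sup>2 * deriv f r) has_fps_expansion D\<^sup>2 * fps_deriv (fps_expansion f 0)"
    unfolding D_def by (intro fps_expansion_intros exp)
  have R: "(\<lambda>r. ((z - c * w * r) * (w - c * z * r) + c\<^sup>2 * r * (1 - c\<^sup>2 * r\<^sup>2)) * f r)
      has_fps_expansion Q * fps_expansion f 0"
    unfolding D_def Q_def by (intro fps_expansion_intros exp)
  have "eventually (\<lambda>r. r \<in> S) (nhds 0)"
    using oS \<open>0 \<in> S\<close> by (rule eventually_nhds_in_open)
  hence ev: "eventually (\<lambda>r. (1 - c\<^sup>2 * r\<^sup>2)\<^sup>2 * deriv f r =
      ((z - c * w * r) * (w - c * z * r) + c\<^sup>2 * r * (1 - c\<^sup>2 * r\<^sup>2)) * f r) (nhds 0)"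
  proof eventually_elim
    case (elim r)
    show ?case
      using DERIV_imp_deriv[OF deriv[OF elim]] nz[OF elim] by (simp add: power_mult_distrib)
  qed
  have "D\<^sup>2 * fps_deriv (fps_expansion f 0) = Q * fps_expansion f 0"
    using fps_expansion_unique_complex[OF L]  R has_fps_expansion_cong[OF ev refl] by blast
  moreover have "D\<^sup>2 * fps_deriv (mehler_fps c z w) = Q * mehler_fps c z w"
    unfolding D_def Q_def by (rule mehler_fps_ode)
  moreover have "D $ 0 = 1" by (simp add: D_def)
  hence "D\<^sup>2 \<noteq> 0" by auto
  moreover have "fps_expansion f 0 $ 0 = 1"
    by (simp add: fps_expansion_def f_def)
  moreover have "mehler_fps c z w $ 0 = 1" by (simp add: mehler_fps_def)
  ultimately have eq: "fps_expansion f 0 = mehler_fps c z w"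
    using fps_linear_ode_unique by blast
  have "r \<in> S" using r by (simp add: S_def)
  \<comment> \<open>For \<open>c = 0\<close> the disc is the whole plane, whereas
    \<open>1 / norm c\<close> would evaluate to 0.\<close>
  define \<rho> where "\<rho> = (if c = 0 then \<infinity> else ereal (1 / norm c))"
  have sub: "eball 0 \<rho> = S"
    by (auto simp: \<rho>_def S_def eball_def norm_mult field_simps)
  have "ereal (norm r) < \<rho>" using r by (auto simp: \<rho>_def norm_mult field_simps)
  moreover have "fps_conv_radius (fps_expansion f 0) \<ge> \<rho>"
    using holo by (intro conv_radius_fps_expansion) (simp add: sub)
  ultimately have "(\<lambda>n. fps_nth (fps_expansion f 0) n * r ^ n) sums eval_fps (fps_expansion f 0) r"
    by (intro sums_eval_fps) auto
  also have "eval_fps (fps_expansion f 0) r = f r"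
    using eval_fps_expansion'[of f 0 \<rho> r] holo \<open>ereal (norm r) < \<rho>\<close> by (simp add: sub)
  finally show ?thesis unfolding eq by (simp add: mehler_fps_def f_def)
qed

section \<open>Orthogonality for an anisotropic Gaussian weight on the plane\<close>

lemma measurable_Complex_pair [measurable]:
  "(\<lambda>(x, y). Complex x y) \<in> borel \<Otimes>\<^sub>M borel \<rightarrow>\<^sub>M borel"
  unfolding borel_prod Complex_eq case_prod_beta
  by (intro borel_measurable_continuous_onI continuous_intros)

text \<open>Lebesgue measure is determined by its values on boxes, and a box in the plane pulls back
  to a product of two intervals. This opens the way to Fubini in Re and Im.\<close>

lemma lborel_complex_eq: "lborel = distr (lborel \<Otimes>\<^sub>M lborel) borel (\<lambda>(x, y). Complex x y)"
proof (rule lborel_eqI)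
  fix l u :: complex
  assume le: "\<And>b. b \<in> Basis \<Longrightarrow> l \<bullet> b \<le> u \<bullet> b"
  have le': "Re l \<le> Re u" "Im l \<le> Im u"
    using le[of 1] le[of \<i>] by (auto simp: Basis_complex_def inner_complex_def)
  have "(\<lambda>(x, y). Complex x y) -` box l u = {Re l<..<Re u} \<times> {Im l<..<Im u}"
    by (auto simp: in_box_complex_iff)
  hence "emeasure (distr (lborel \<Otimes>\<^sub>M lborel) borel (\<lambda>(x, y). Complex x y)) (box l u) =
      emeasure (lborel \<Otimes>\<^sub>M lborel) ({Re l<..<Re u} \<times> {Im l<..<Im u})"
    by (subst emeasure_distr) (auto simp: space_pair_measure)
  also have "\<dots> = ennreal (Re u - Re l) * ennreal (Im u - Im l)"
    using le' by (subst lborel.emeasure_pair_measure_Times) auto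
  also have "\<dots> = ennreal (\<Prod>b\<in>Basis. (u - l) \<bullet> b)"
    using le' by (simp add: Basis_complex_def inner_complex_def ennreal_mult)
  finally show "emeasure (distr (lborel \<Otimes>\<^sub>M lborel) borel (\<lambda>(x, y). Complex x y)) (box l u) =
      (\<Prod>b\<in>Basis. (u - l) \<bullet> b)"
    by simp
qed simp

lemma
  fixes f :: "complex \<Rightarrow> 'a :: {banach, second_countable_topology}"
  assumes [measurable]: "f \<in> borel_measurable borel"
  shows integrable_complex_iff:
      "integrable lborel f \<longleftrightarrow> integrable (lborel \<Otimes>\<^sub>M lborel) (\<lambda>(x, y). f (Complex x y))"
    and integral_complex_eq:
      "integral\<^sup>L lborel f = (\<integral>(x, y). f (Complex x y) \<partial>(lborel \<Otimes>\<^sub>M lborel))"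
  by (subst lborel_complex_eq, simp add: integrable_distr_eq integral_distr case_prod_unfold)+

lemma integral_complex_fst:
  fixes f :: "complex \<Rightarrow> 'a :: {banach, second_countable_topology}"
  assumes "integrable lborel f"
  shows "integral\<^sup>L lborel f = (\<integral>x. \<integral>y. f (Complex x y) \<partial>lborel \<partial>lborel)"
proof -
  have [measurable]: "f \<in> borel_measurable borel" using assms by auto
  show ?thesis
    using lborel_pair.integral_fst[of "\<lambda>x y. f (Complex x y)"] assms
    by (simp add: integral_complex_eq integrable_complex_iff)
qed

lemma integral_complex_snd:
  fixes f :: "complex \<Rightarrow> 'a :: {banach, second_countable_topology}"
  assumes "integrable lborel f"
  shows "integral\<^sup>L lborel f = (\<integral>y. \<integral>x. f (Complex x y) \<partial>lborel \<partial>lborel)"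
proof -
  have [measurable]: "f \<in> borel_measurable borel" using assms by auto
  show ?thesis
    using lborel_pair.integral_snd[of "\<lambda>x y. f (Complex x y)"] assms
    by (simp add: integral_complex_eq integrable_complex_iff)
qed

lemma integrable_pair_mult:
  fixes f g :: "real \<Rightarrow> real"
  assumes f: "integrable lborel f" and g: "integrable lborel g"
  shows "integrable (lborel \<Otimes>\<^sub>M lborel) (\<lambda>(x, y). f x * g y)"
proof (rule lborel_pair.Fubini_integrable)
  have [measurable]: "f \<in> borel_measurable borel" "g \<in> borel_measurable borel" using f g by auto
  show "(\<lambda>(x, y). f x * g y) \<in> borel_measurable (lborel \<Otimes>\<^sub>M lborel)" by measurable
  show "integrable lborel (\<lambda>x. \<integral>y. norm (case (x, y) of (x, y) \<Rightarrow> f x * g y) \<partial>lborel)"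
    using f by (simp add: abs_mult)
qed (use g in auto)

section \<open>One-dimensional Gaussian moments and integration by parts\<close>

definition gauss_moment :: "real \<Rightarrow> nat \<Rightarrow> real" where
  "gauss_moment \<alpha> k = (if even k then sqrt (pi / \<alpha>) * fact k / ((4 * \<alpha>) ^ (k div 2) * fact (k div 2)) else 0)"

lemma gauss_moment:
  assumes "\<alpha> > 0"
  shows "has_bochner_integral lborel (\<lambda>x. x ^ k * exp (- (\<alpha> * x\<^sup>2))) (gauss_moment \<alpha> k)"
proof -
  define \<sigma> where "\<sigma> = 1 / sqrt (2 * \<alpha>)"
  have \<sigma>: "\<sigma> > 0" "\<sigma>\<^sup>2 = 1 / (2 * \<alpha>)" using assms by (auto simp: \<sigma>_def power_divide)
  have nd: "sqrt (pi / \<alpha>) * normal_density 0 \<sigma> x = exp (- (\<alpha> * x\<^sup>2))" for x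
    using assms by (simp add: normal_density_def \<sigma> real_sqrt_divide)
  show ?thesis
  proof (cases "even k")
    case True
    then obtain j where k: "k = 2 * j" by (elim evenE)
    have "has_bochner_integral lborel (\<lambda>x. sqrt (pi / \<alpha>) * (normal_density 0 \<sigma> x * (x - 0) ^ (2 * j)))
        (sqrt (pi / \<alpha>) * (fact (2 * j) / ((2 / \<sigma>\<^sup>2) ^ j * fact j)))"
      by (intro has_bochner_integral_mult_right normal_moment_even[OF \<sigma>(1)])
    thus ?thesis
      using assms unfolding nd[symmetric] gauss_moment_def k by (simp add: \<sigma> mult_ac)
  next
    case False
    then obtain j where k: "k = 2 * j + 1" by (elim oddE)
    have "has_bochner_integral lborel (\<lambda>x. sqrt (pi / \<alpha>) * (normal_density 0 \<sigma> x * (x - 0) ^ (2 * j + 1)))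
        (sqrt (pi / \<alpha>) * 0)"
      by (intro has_bochner_integral_mult_right normal_moment_odd[OF \<sigma>(1)])
    thus ?thesis
      unfolding nd[symmetric] gauss_moment_def k by (simp add: mult_ac)
  qed
qed

text \<open>Integration by parts for the monomial \<open>x^k\<close>, read off from the explicit
  moments, so that no boundary terms at infinity have to be controlled.\<close>

lemma gauss_moment_rec:
  assumes "\<alpha> > 0"
  shows "2 * \<alpha> * gauss_moment \<alpha> (Suc k) = real k * gauss_moment \<alpha> (k - 1)"
proof (cases "even k")
  case True
  \<comment> \<open>Both moments have odd order and vanish, except that for \<open>k = 0\<close> the
    index \<open>k - 1\<close> is 0; there the factor \<open>real k\<close> is zero.\<close>
  thus ?thesis by (cases k) (auto simp: gauss_moment_def)
next
  case False
  then obtain j where k: "k = 2 * j + 1" by (elim oddE)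
  define F :: real where "F = fact (2 * j)"
  define G :: real where "G = fact j"
  have F: "fact (Suc (2 * j + 1)) = (2 * real j + 2) * ((2 * real j + 1) * F)"
    by (simp add: F_def algebra_simps)
  have G: "fact (Suc j) = (real j + 1) * G" "G > 0"
    by (simp_all add: G_def algebra_simps)
  have 1: "gauss_moment \<alpha> (Suc k) = sqrt (pi / \<alpha>) * fact (Suc (2 * j + 1)) / ((4 * \<alpha>) ^ Suc j * fact (Suc j))"
    by (simp add: gauss_moment_def k del: fact_Suc power_Suc)
  have 2: "gauss_moment \<alpha> (k - 1) = sqrt (pi / \<alpha>) * F / ((4 * \<alpha>) ^ j * G)"
    by (simp add: gauss_moment_def k F_def G_def)
  show ?thesis
    using assms G(2) unfolding 1 2 F G(1) unfolding k by (simp add: divide_simps)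
qed

text \<open>Linear extension of \<open>gauss_moment_rec\<close> from monomials to
  polynomials.\<close>

lemma gauss_ibp_poly:
  fixes q :: "complex poly"
  assumes "\<alpha> > 0"
  shows "integrable lborel (\<lambda>x. poly q (of_real x) * of_real (exp (- (\<alpha> * x\<^sup>2))))"
    and "(\<integral>x. poly (pderiv q) (of_real x) * of_real (exp (- (\<alpha> * x\<^sup>2))) \<partial>lborel) =
         (\<integral>x. of_real (2 * \<alpha> * x) * poly q (of_real x) * of_real (exp (- (\<alpha> * x\<^sup>2))) \<partial>lborel)"
proof -
  define I where "I = (\<lambda>q. \<Sum>k\<le>degree q. coeff q k * of_real (gauss_moment \<alpha> k))"
  have mono: "has_bochner_integral lborel
     (\<lambda>x. c * of_real x ^ k * of_real (exp (- (\<alpha> * x\<^sup>2)))) (c * of_real (gauss_moment \<alpha> k))" for c :: complex and k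
    using has_bochner_integral_mult_right[OF has_bochner_integral_of_real[OF gauss_moment[OF assms, of k]], of c]
    by (simp add: mult.assoc)
  have I: "has_bochner_integral lborel
      (\<lambda>x. poly q (of_real x) * of_real (exp (- (\<alpha> * x\<^sup>2))))
      (\<Sum>k\<le>n. coeff q k * of_real (gauss_moment \<alpha> k))" if "degree q \<le> n" for q :: "complex poly" and n
  proof -
    have "poly q x = (\<Sum>k\<le>n. coeff q k * x ^ k)" for x
      unfolding poly_altdef using that by (intro sum.mono_neutral_left) (auto simp: coeff_eq_0)
    thus ?thesis
      by (auto simp: sum_distrib_right intro!: has_bochner_integral_sum mono)
  qed
  show "integrable lborel (\<lambda>x. poly q (of_real x) * of_real (exp (- (\<alpha> * x\<^sup>2))))"
    using I[OF order_refl] by (rule integrable.intros)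
  let ?n = "Suc (degree q)"
  have "(\<integral>x. of_real (2 * \<alpha> * x) * poly q (of_real x) * of_real (exp (- (\<alpha> * x\<^sup>2))) \<partial>lborel) =
     (\<integral>x. of_real (2 * \<alpha>) * (poly (pCons 0 q) (of_real x) * of_real (exp (- (\<alpha> * x\<^sup>2)))) \<partial>lborel)"
    by (simp add: mult_ac)
  also have "\<dots> = of_real (2 * \<alpha>) * (\<Sum>k\<le>?n. coeff (pCons 0 q) k * of_real (gauss_moment \<alpha> k))"
    by (subst integral_mult_right_zero, subst has_bochner_integral_integral_eq[OF I])
       (auto simp: degree_pCons_le)
  also have "\<dots> = (\<Sum>k\<le>degree q. coeff q k * of_real (2 * \<alpha> * gauss_moment \<alpha> (Suc k)))"
    by (subst sum.atMost_Suc_shift) (simp add: sum_distrib_left mult_ac)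
  also have "\<dots> = (\<Sum>k\<le>degree q. coeff q k * of_real (real k * gauss_moment \<alpha> (k - 1)))"
    by (simp only: gauss_moment_rec[OF assms])
  also have "\<dots> = (\<Sum>k\<le>?n. coeff q k * of_real (real k * gauss_moment \<alpha> (k - 1)))"
    by (simp add: coeff_eq_0)
  also have "\<dots> = (\<Sum>k\<le>degree q. coeff (pderiv q) k * of_real (gauss_moment \<alpha> k))"
    by (subst sum.atMost_Suc_shift) (simp add: coeff_pderiv mult_ac)
  also have "\<dots> = (\<integral>x. poly (pderiv q) (of_real x) * of_real (exp (- (\<alpha> * x\<^sup>2))) \<partial>lborel)"
    by (subst has_bochner_integral_integral_eq[OF I]) (auto simp: degree_pderiv)
  finally show "(\<integral>x. poly (pderiv q) (of_real x) * of_real (exp (- (\<alpha> * x\<^sup>2))) \<partial>lborel) =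
         (\<integral>x. of_real (2 * \<alpha> * x) * poly q (of_real x) * of_real (exp (- (\<alpha> * x\<^sup>2))) \<partial>lborel)" ..
qed

text \<open>The product of \<open>g\<close> with the conjugate of \<open>f\<close> is not a
  polynomial in z, but along a line \<open>a + b x\<close> with x real it is a polynomial in x:
  conjugate the coefficients of \<open>f\<close> and of the line. The directions needed are b = 1
  and b = \<i>.\<close>

lemma gauss_ibp_line:
  fixes f g :: "complex poly" and a b :: complex
  assumes "\<alpha> > 0"
  defines "w \<equiv> \<lambda>x. of_real (exp (- (\<alpha> * x\<^sup>2))) :: complex"
  shows "(\<integral>x. (cnj b * cnj (poly (pderiv f) (a + b * of_real x)) * poly g (a + b * of_real x)
             + b * cnj (poly f (a + b * of_real x)) * poly (pderiv g) (a + b * of_real x)) * w x \<partial>lborel) =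
         (\<integral>x. of_real (2 * \<alpha> * x) * cnj (poly f (a + b * of_real x)) * poly g (a + b * of_real x) * w x \<partial>lborel)"
proof -
  define q where "q = pcompose (map_poly cnj f) [:cnj a, cnj b:] * pcompose g [:a, b:]"
  have [simp]: "pderiv (map_poly cnj f) = map_poly cnj (pderiv f)"
    by (rule poly_eqI) (simp add: coeff_pderiv coeff_map_poly)
  have q: "poly q (of_real x) = cnj (poly f (a + b * of_real x)) * poly g (a + b * of_real x)" for x :: real
    by (simp add: q_def poly_pcompose mult_ac)
  have "poly (pderiv q) (of_real x) =
      cnj b * cnj (poly (pderiv f) (a + b * of_real x)) * poly g (a + b * of_real x)
       + b * cnj (poly f (a + b * of_real x)) * poly (pderiv g) (a + b * of_real x)" for x :: real
    by (simp add: q_def pderiv_mult pderiv_pcompose poly_pcompose pderiv_pCons mult_ac)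
  thus ?thesis
    using gauss_ibp_poly(2)[OF assms(1), of q] by (simp add: q w_def mult_ac)
qed

section \<open>Integrability and integration by parts in the plane\<close>

definition gauss_weight :: "real \<Rightarrow> real \<Rightarrow> complex \<Rightarrow> complex" where
  "gauss_weight \<alpha> \<beta> z = of_real (exp (- (\<alpha> * (Re z)\<^sup>2)) * exp (- (\<beta> * (Im z)\<^sup>2)))"

lemma integrable_gauss_poly:
  assumes "\<alpha> > 0" "\<beta> > 0"
  shows "integrable lborel (\<lambda>z. cnj (poly f z) * poly g z * gauss_weight \<alpha> \<beta> z)"
proof -
  \<comment> \<open>Asking for integrability after multiplication by every monomial in Re z and Im z
    makes the class closed under multiplication by z and by \<open>cnj z\<close>. It then contains
    all products of a polynomial and a conjugated polynomial.\<close>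
  define I where "I = {h. \<forall>i j. integrable lborel
     (\<lambda>z. h z * of_real (Re z ^ i * Im z ^ j) * gauss_weight \<alpha> \<beta> z)}"
  have one: "(\<lambda>_. 1) \<in> I"
    unfolding I_def
  proof safe
    fix i j
    have [measurable]: "gauss_weight \<alpha> \<beta> \<in> borel_measurable borel"
      unfolding gauss_weight_def by measurable
    have "integrable (lborel \<Otimes>\<^sub>M lborel)
       (\<lambda>(x, y). x ^ i * exp (- (\<alpha> * x\<^sup>2)) * (y ^ j * exp (- (\<beta> * y\<^sup>2))))"
      by (intro integrable_pair_mult integrable.intros[OF gauss_moment] assms)
    hence "integrable (lborel \<Otimes>\<^sub>M lborel)
       (\<lambda>p. complex_of_real (case p of (x, y) \<Rightarrow> x ^ i * exp (- (\<alpha> * x\<^sup>2)) * (y ^ j * exp (- (\<beta> * y\<^sup>2)))))"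
      by (rule integrable_of_real)
    thus "integrable lborel (\<lambda>z. 1 * complex_of_real (Re z ^ i * Im z ^ j) * gauss_weight \<alpha> \<beta> z)"
      by (subst integrable_complex_iff) (simp_all add: gauss_weight_def case_prod_unfold mult_ac)
  qed
  have add: "(\<lambda>z. h z + k z) \<in> I" if "h \<in> I" "k \<in> I" for h k
    using that unfolding I_def by (auto simp: ring_distribs)
  have smult: "(\<lambda>z. c * h z) \<in> I" if "h \<in> I" for h c
    using that unfolding I_def by (auto simp: mult.assoc)
  have Re: "(\<lambda>z. of_real (Re z) * h z) \<in> I" if "h \<in> I" for h
    unfolding I_def
  proof safe
    fix i j
    show "integrable lborel
       (\<lambda>z. of_real (Re z) * h z * of_real (Re z ^ i * Im z ^ j) * gauss_weight \<alpha> \<beta> z)"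
      using that[unfolded I_def, THEN CollectD, rule_format, of "Suc i" j] by (simp add: mult_ac)
  qed
  have Im: "(\<lambda>z. of_real (Im z) * h z) \<in> I" if "h \<in> I" for h
    unfolding I_def
  proof safe
    fix i j
    show "integrable lborel
       (\<lambda>z. of_real (Im z) * h z * of_real (Re z ^ i * Im z ^ j) * gauss_weight \<alpha> \<beta> z)"
      using that[unfolded I_def, THEN CollectD, rule_format, of i "Suc j"] by (simp add: mult_ac)
  qed
  have var: "(\<lambda>z. z * h z) \<in> I" if "h \<in> I" for h
  proof -
    have "(\<lambda>z. of_real (Re z) * h z + \<i> * (of_real (Im z) * h z)) \<in> I"
      using that by (intro add Re smult Im)
    also have "(\<lambda>z. of_real (Re z) * h z + \<i> * (of_real (Im z) * h z)) = (\<lambda>z. z * h z)"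
      by (subst (5) complex_eq) (simp add: algebra_simps)
    finally show ?thesis .
  qed
  have var_cnj: "(\<lambda>z. cnj z * h z) \<in> I" if "h \<in> I" for h
  proof -
    have "(\<lambda>z. of_real (Re z) * h z + (- \<i>) * (of_real (Im z) * h z)) \<in> I"
      using that by (intro add Re smult Im)
    also have "(\<lambda>z. of_real (Re z) * h z + (- \<i>) * (of_real (Im z) * h z)) = (\<lambda>z. cnj z * h z)"
      by (rule ext) (simp add: complex_eq_iff algebra_simps)
    finally show ?thesis .
  qed
  have poly: "(\<lambda>z. poly g z * h z) \<in> I" if h: "h \<in> I" for g h
  proof (induction g)
    case 0
    show ?case using smult[OF h, of 0] by simp
  next
    case (pCons a g)
    have "(\<lambda>z. a * h z + z * (poly g z * h z)) \<in> I"
      by (intro add smult var h pCons)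
    thus ?case by (simp add: algebra_simps)
  qed
  have poly_cnj: "(\<lambda>z. cnj (poly f z) * h z) \<in> I" if h: "h \<in> I" for f h
  proof (induction f)
    case 0
    show ?case using smult[OF h, of 0] by simp
  next
    case (pCons a f)
    have "(\<lambda>z. cnj a * h z + cnj z * (cnj (poly f z) * h z)) \<in> I"
      by (intro add smult var_cnj h pCons)
    thus ?case by (simp add: algebra_simps)
  qed
  have "(\<lambda>z. cnj (poly f z) * (poly g z * 1)) \<in> I"
    by (intro poly_cnj poly one)
  from this[unfolded I_def, THEN CollectD, rule_format, of 0 0] show ?thesis
    by simp
qed

lemma integrable_gauss_poly_linear:
  assumes "\<alpha> > 0" "\<beta> > 0"
  shows "integrable lborel (\<lambda>z. of_real (Re z) * cnj (poly f z) * poly g z * gauss_weight \<alpha> \<beta> z)"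
    and "integrable lborel (\<lambda>z. of_real (Im z) * cnj (poly f z) * poly g z * gauss_weight \<alpha> \<beta> z)"
proof -
  have f: "integrable lborel (\<lambda>z. cnj z * cnj (poly f z) * poly g z * gauss_weight \<alpha> \<beta> z)"
    using integrable_gauss_poly[OF assms, of "pCons 0 f" g] by simp
  have g: "integrable lborel (\<lambda>z. z * cnj (poly f z) * poly g z * gauss_weight \<alpha> \<beta> z)"
    using integrable_gauss_poly[OF assms, of f "pCons 0 g"] by (simp add: mult_ac)
  have "of_real (Re z) * cnj (poly f z) * poly g z * gauss_weight \<alpha> \<beta> z =
      1 / 2 * (z * cnj (poly f z) * poly g z * gauss_weight \<alpha> \<beta> z)
      + 1 / 2 * (cnj z * cnj (poly f z) * poly g z * gauss_weight \<alpha> \<beta> z)" for z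
  proof -
    have "of_real (Re z) = 1 / 2 * z + 1 / 2 * cnj z"
      by (simp add: complex_eq_iff)
    thus ?thesis by (simp only: ring_distribs mult.assoc)
  qed
  thus "integrable lborel (\<lambda>z. of_real (Re z) * cnj (poly f z) * poly g z * gauss_weight \<alpha> \<beta> z)"
    using f g by simp
  have "of_real (Im z) * cnj (poly f z) * poly g z * gauss_weight \<alpha> \<beta> z =
      - (\<i> / 2) * (z * cnj (poly f z) * poly g z * gauss_weight \<alpha> \<beta> z)
      + \<i> / 2 * (cnj z * cnj (poly f z) * poly g z * gauss_weight \<alpha> \<beta> z)" for z
  proof -
    have "of_real (Im z) = - (\<i> / 2) * z + \<i> / 2 * cnj z"
      by (simp add: complex_eq_iff)
    thus ?thesis by (simp only: ring_distribs mult.assoc)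
  qed
  thus "integrable lborel (\<lambda>z. of_real (Im z) * cnj (poly f z) * poly g z * gauss_weight \<alpha> \<beta> z)"
    using f g by simp
qed

text \<open>Fubini with x innermost reduces this to \<open>gauss_ibp_line\<close> on the horizontal
  line through \<open>\<i> * y\<close>.\<close>

lemma gauss_ibp_Re:
  assumes "\<alpha> > 0" "\<beta> > 0"
  shows "(\<integral>z. (cnj (poly (pderiv f) z) * poly g z + cnj (poly f z) * poly (pderiv g) z)
            * gauss_weight \<alpha> \<beta> z \<partial>lborel) =
         of_real (2 * \<alpha>) * (\<integral>z. of_real (Re z) * cnj (poly f z) * poly g z * gauss_weight \<alpha> \<beta> z \<partial>lborel)"
proof -
  note int = integrable_gauss_poly[OF assms] integrable_gauss_poly_linear[OF assms]
  have "(\<integral>x. (cnj (poly (pderiv f) (Complex x y)) * poly g (Complex x y)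
          + cnj (poly f (Complex x y)) * poly (pderiv g) (Complex x y)) * gauss_weight \<alpha> \<beta> (Complex x y) \<partial>lborel) =
        (\<integral>x. of_real (2 * \<alpha>) * (of_real x * cnj (poly f (Complex x y)) * poly g (Complex x y) *
            gauss_weight \<alpha> \<beta> (Complex x y)) \<partial>lborel)" for y
  proof -
    have xy: "Complex x y = \<i> * of_real y + 1 * of_real x" for x
      by (simp add: complex_eq_iff)
    have w: "gauss_weight \<alpha> \<beta> (Complex x y) =
        of_real (exp (- (\<beta> * y\<^sup>2))) * of_real (exp (- (\<alpha> * x\<^sup>2)))" for x
      by (simp add: gauss_weight_def)
    show ?thesis
      using arg_cong[OF gauss_ibp_line[OF assms(1), of 1 f "\<i> * of_real y" g],
          of "\<lambda>I. of_real (exp (- (\<beta> * y\<^sup>2))) * I"]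
      unfolding w unfolding xy integral_mult_right_zero[symmetric] by (simp add: mult_ac)
  qed
  hence eq: "(\<integral>x. (cnj (poly (pderiv f) (Complex x y)) * poly g (Complex x y) + cnj (poly f (Complex x y)) * poly (pderiv g) (Complex x y)) * gauss_weight \<alpha> \<beta> (Complex x y) \<partial>lborel) =
      (\<integral>x. of_real (2 * \<alpha>) * (of_real (Re (Complex x y)) * cnj (poly f (Complex x y)) * poly g (Complex x y) *
            gauss_weight \<alpha> \<beta> (Complex x y)) \<partial>lborel)" for y
    by simp
  have I1: "integrable lborel (\<lambda>z. (cnj (poly (pderiv f) z) * poly g z + cnj (poly f z) * poly (pderiv g) z) * gauss_weight \<alpha> \<beta> z)"
    by (auto simp: ring_distribs mult.assoc int[unfolded mult.assoc])
  have I2: "integrable lborel (\<lambda>z. of_real (2 * \<alpha>) * (of_real (Re z) * cnj (poly f z) * poly g z * gauss_weight \<alpha> \<beta> z))"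
    by (intro integrable_mult_right int)
  have "(\<integral>z. (cnj (poly (pderiv f) z) * poly g z + cnj (poly f z) * poly (pderiv g) z) * gauss_weight \<alpha> \<beta> z \<partial>lborel) =
      (\<integral>z. of_real (2 * \<alpha>) * (of_real (Re z) * cnj (poly f z) * poly g z * gauss_weight \<alpha> \<beta> z) \<partial>lborel)"
    unfolding integral_complex_snd[OF I1] integral_complex_snd[OF I2] eq by (rule refl)
  thus ?thesis by (subst (asm) integral_mult_right_zero)
qed

text \<open>The vertical counterpart. The chain rule in y puts \<i> on the derivative of
  \<open>g\<close> and, through conjugation, -\<i> on that of \<open>f\<close>.\<close>

lemma gauss_ibp_Im:
  assumes "\<alpha> > 0" "\<beta> > 0"
  shows "(\<integral>z. (- \<i> * cnj (poly (pderiv f) z) * poly g z + \<i> * cnj (poly f z) * poly (pderiv g) z)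
            * gauss_weight \<alpha> \<beta> z \<partial>lborel) =
         of_real (2 * \<beta>) * (\<integral>z. of_real (Im z) * cnj (poly f z) * poly g z * gauss_weight \<alpha> \<beta> z \<partial>lborel)"
proof -
  note int = integrable_gauss_poly[OF assms] integrable_gauss_poly_linear[OF assms]
  have "(\<integral>y. (- \<i> * cnj (poly (pderiv f) (Complex x y)) * poly g (Complex x y)
          + \<i> * cnj (poly f (Complex x y)) * poly (pderiv g) (Complex x y)) * gauss_weight \<alpha> \<beta> (Complex x y) \<partial>lborel) =
        (\<integral>y. of_real (2 * \<beta>) * (of_real y * cnj (poly f (Complex x y)) * poly g (Complex x y) *
            gauss_weight \<alpha> \<beta> (Complex x y)) \<partial>lborel)" for x
  proof -
    have xy: "Complex x y = of_real x + \<i> * of_real y" for y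
      by (simp add: complex_eq_iff)
    have w: "gauss_weight \<alpha> \<beta> (Complex x y) =
        of_real (exp (- (\<alpha> * x\<^sup>2))) * of_real (exp (- (\<beta> * y\<^sup>2)))" for y
      by (simp add: gauss_weight_def)
    show ?thesis
      using arg_cong[OF gauss_ibp_line[OF assms(2), of \<i> f "of_real x" g],
          of "\<lambda>I. of_real (exp (- (\<alpha> * x\<^sup>2))) * I"]
      unfolding w unfolding xy integral_mult_right_zero[symmetric] by (simp add: mult_ac)
  qed
  hence eq: "(\<integral>y. (- \<i> * cnj (poly (pderiv f) (Complex x y)) * poly g (Complex x y) + \<i> * cnj (poly f (Complex x y)) * poly (pderiv g) (Complex x y)) * gauss_weight \<alpha> \<beta> (Complex x y) \<partial>lborel) =
      (\<integral>y. of_real (2 * \<beta>) * (of_real (Im (Complex x y)) * cnj (poly f (Complex x y)) * poly g (Complex x y) *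
            gauss_weight \<alpha> \<beta> (Complex x y)) \<partial>lborel)" for x
    by simp
  have I1: "integrable lborel (\<lambda>z. (- \<i> * cnj (poly (pderiv f) z) * poly g z + \<i> * cnj (poly f z) * poly (pderiv g) z) * gauss_weight \<alpha> \<beta> z)"
    by (auto simp: ring_distribs mult.assoc int[unfolded mult.assoc])
  have I2: "integrable lborel (\<lambda>z. of_real (2 * \<beta>) * (of_real (Im z) * cnj (poly f z) * poly g z * gauss_weight \<alpha> \<beta> z))"
    by (intro integrable_mult_right int)
  have "(\<integral>z. (- \<i> * cnj (poly (pderiv f) z) * poly g z + \<i> * cnj (poly f z) * poly (pderiv g) z) * gauss_weight \<alpha> \<beta> z \<partial>lborel) =
      (\<integral>z. of_real (2 * \<beta>) * (of_real (Im z) * cnj (poly f z) * poly g z * gauss_weight \<alpha> \<beta> z) \<partial>lborel)"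
    unfolding integral_complex_fst[OF I1] integral_complex_fst[OF I2] eq by (rule refl)
  thus ?thesis by (subst (asm) integral_mult_right_zero)
qed

section \<open>The weighted inner product, its ladder relations and the Hermite norms\<close>

definition gauss_inner :: "real \<Rightarrow> real \<Rightarrow> complex poly \<Rightarrow> complex poly \<Rightarrow> complex" where
  "gauss_inner \<alpha> \<beta> f g = (\<integral>z. cnj (poly f z) * poly g z * gauss_weight \<alpha> \<beta> z \<partial>lborel)"

context
  fixes \<alpha> \<beta> :: real
  assumes pos: "\<alpha> > 0" "\<beta> > 0"
begin

lemma gauss_inner_1_1: "gauss_inner \<alpha> \<beta> 1 1 = of_real (pi / sqrt (\<alpha> * \<beta>))"
proof -
  have int: "(\<integral>x. exp (- (c * x\<^sup>2)) \<partial>lborel) = sqrt (pi / c)" if "c > 0" for c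
    using has_bochner_integral_integral_eq[OF gauss_moment[OF that, of 0]]
    by (simp add: gauss_moment_def)
  have "gauss_inner \<alpha> \<beta> 1 1 = (\<integral>x. of_real (exp (- (\<alpha> * x\<^sup>2))) * of_real (sqrt (pi / \<beta>)) \<partial>lborel)"
    unfolding gauss_inner_def using integrable_gauss_poly[OF pos, of 1 1]
    by (subst integral_complex_fst) (simp_all add: gauss_weight_def int[OF pos(2)])
  also have "\<dots> = of_real (sqrt (pi / \<alpha>) * sqrt (pi / \<beta>))"
    by (simp add: int[OF pos(1)])
  also have "sqrt (pi / \<alpha>) * sqrt (pi / \<beta>) = pi / sqrt (\<alpha> * \<beta>)"
    by (simp add: real_sqrt_divide real_sqrt_mult)
  finally show ?thesis .
qed

lemma gauss_inner_add_right: "gauss_inner \<alpha> \<beta> f (g + h) = gauss_inner \<alpha> \<beta> f g + gauss_inner \<alpha> \<beta> f h"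
  unfolding gauss_inner_def
  by (subst Bochner_Integration.integral_add[symmetric])
     (auto simp: integrable_gauss_poly[OF pos] ring_distribs)

lemma gauss_inner_smult_right: "gauss_inner \<alpha> \<beta> f (smult c g) = c * gauss_inner \<alpha> \<beta> f g"
  unfolding gauss_inner_def
  by (subst integral_mult_right_zero[symmetric]) (simp add: mult_ac)

lemma gauss_inner_cnj: "cnj (gauss_inner \<alpha> \<beta> f g) = gauss_inner \<alpha> \<beta> g f"
  unfolding gauss_inner_def
  by (subst Bochner_Integration.integral_cnj[symmetric]) (simp add: gauss_weight_def mult_ac)

lemma gauss_inner_0_right [simp]: "gauss_inner \<alpha> \<beta> f 0 = 0"
  by (simp add: gauss_inner_def)

lemma gauss_inner_diff_right: "gauss_inner \<alpha> \<beta> f (g - h) = gauss_inner \<alpha> \<beta> f g - gauss_inner \<alpha> \<beta> f h"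
  using gauss_inner_add_right[of f g "smult (-1) h"] gauss_inner_smult_right[of f "-1" h] by simp

lemma gauss_inner_diff_left: "gauss_inner \<alpha> \<beta> (f - g) h = gauss_inner \<alpha> \<beta> f h - gauss_inner \<alpha> \<beta> g h"
  by (subst (1 2 3) gauss_inner_cnj[symmetric]) (simp add: gauss_inner_diff_right)

lemma gauss_inner_smult_left: "gauss_inner \<alpha> \<beta> (smult c f) g = cnj c * gauss_inner \<alpha> \<beta> f g"
  by (subst (1 2) gauss_inner_cnj[symmetric]) (simp add: gauss_inner_smult_right)

text \<open>Integration by parts for the Wirtinger derivative d/dz, which annihilates the conjugate
  of \<open>f\<close>. It multiplies the weight by \<open>-(\<alpha> x - \<i> \<beta> y)\<close>,
  and \<open>2 (\<alpha> x - \<i> \<beta> y) = (\<alpha> + \<beta>) cnj z - (\<beta> - \<alpha>)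
  z\<close>. Multiplication by z is \<open>pCons 0\<close>.\<close>

lemma gauss_inner_pderiv_right:
  "2 * gauss_inner \<alpha> \<beta> f (pderiv g) =
     of_real (\<alpha> + \<beta>) * gauss_inner \<alpha> \<beta> (pCons 0 f) g - of_real (\<beta> - \<alpha>) * gauss_inner \<alpha> \<beta> f (pCons 0 g)"
proof -
  note int = integrable_gauss_poly[OF pos] integrable_gauss_poly_linear[OF pos]
  let ?w = "gauss_weight \<alpha> \<beta>"
  define P where "P = gauss_inner \<alpha> \<beta> (pderiv f) g"
  define Q where "Q = gauss_inner \<alpha> \<beta> f (pderiv g)"
  define X where "X = (\<integral>z. of_real (Re z) * cnj (poly f z) * poly g z * ?w z \<partial>lborel)"
  define Y where "Y = (\<integral>z. of_real (Im z) * cnj (poly f z) * poly g z * ?w z \<partial>lborel)"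
  have "P + Q = of_real (2 * \<alpha>) * X"
    using gauss_ibp_Re[OF pos, of f g]
    unfolding P_def Q_def X_def gauss_inner_def
    by (subst Bochner_Integration.integral_add[symmetric]) (auto simp: int ring_distribs)
  moreover have "- \<i> * P + \<i> * Q = of_real (2 * \<beta>) * Y"
    using gauss_ibp_Im[OF pos, of f g]
    unfolding P_def Q_def Y_def gauss_inner_def
    by (subst (1 2) integral_mult_right_zero[symmetric],
        subst Bochner_Integration.integral_add[symmetric])
       (auto simp: int[unfolded mult.assoc] ring_distribs mult.assoc)
  moreover have "gauss_inner \<alpha> \<beta> (pCons 0 f) g = X - \<i> * Y"
  proof -
    have "cnj (poly (pCons 0 f) z) * poly g z * ?w z =
        of_real (Re z) * cnj (poly f z) * poly g z * ?w z
         - \<i> * (of_real (Im z) * cnj (poly f z) * poly g z * ?w z)" for z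
    proof -
      have "cnj z = of_real (Re z) - \<i> * of_real (Im z)" by (simp add: complex_eq_iff)
      thus ?thesis by (simp only: poly_pCons add_0 complex_cnj_mult) (simp add: algebra_simps)
    qed
    thus ?thesis unfolding gauss_inner_def X_def Y_def
      by (simp add: int)
  qed
  moreover have "gauss_inner \<alpha> \<beta> f (pCons 0 g) = X + \<i> * Y"
  proof -
    have "cnj (poly f z) * poly (pCons 0 g) z * ?w z =
        of_real (Re z) * cnj (poly f z) * poly g z * ?w z
         + \<i> * (of_real (Im z) * cnj (poly f z) * poly g z * ?w z)" for z
    proof -
      have "z * u = of_real (Re z) * u + \<i> * (of_real (Im z) * u)" for u
        by (simp add: complex_eq_iff)
      from this[of "cnj (poly f z) * poly g z * ?w z"] show ?thesis
        by (simp only: poly_pCons add_0 mult_ac)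
    qed
    thus ?thesis unfolding gauss_inner_def X_def Y_def
      by (simp add: int)
  qed
  moreover have "\<i> * \<i> = -1" by simp
  ultimately show ?thesis
    unfolding Q_def[symmetric] of_real_mult of_real_add of_real_diff of_real_numeral by algebra
qed

lemma gauss_inner_pderiv_left:
  "2 * gauss_inner \<alpha> \<beta> (pderiv f) g =
     of_real (\<alpha> + \<beta>) * gauss_inner \<alpha> \<beta> f (pCons 0 g) - of_real (\<beta> - \<alpha>) * gauss_inner \<alpha> \<beta> (pCons 0 f) g"
  using arg_cong[OF gauss_inner_pderiv_right[of g f], of cnj] by (simp add: gauss_inner_cnj)

text \<open>The two preceding relations are linear in the products with \<open>pCons 0 f\<close> and
  with \<open>pCons 0 g\<close>; the determinant is \<open>(\<alpha> + \<beta>)^2 - (\<beta> -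
  \<alpha>)^2 = 4 \<alpha> \<beta>\<close>, and solving gives this.\<close>

lemma gauss_inner_pCons_left:
  "of_real (2 * \<alpha> * \<beta>) * gauss_inner \<alpha> \<beta> (pCons 0 f) g =
     of_real (\<alpha> + \<beta>) * gauss_inner \<alpha> \<beta> f (pderiv g)
       + of_real (\<beta> - \<alpha>) * gauss_inner \<alpha> \<beta> (pderiv f) g"
proof -
  have "2 * (of_real (2 * \<alpha> * \<beta>) * gauss_inner \<alpha> \<beta> (pCons 0 f) g) =
     of_real (\<alpha> + \<beta>) * (2 * gauss_inner \<alpha> \<beta> f (pderiv g))
       + of_real (\<beta> - \<alpha>) * (2 * gauss_inner \<alpha> \<beta> (pderiv f) g)"
    unfolding gauss_inner_pderiv_left gauss_inner_pderiv_right by (simp add: algebra_simps)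
  also have "\<dots> = 2 * (of_real (\<alpha> + \<beta>) * gauss_inner \<alpha> \<beta> f (pderiv g)
       + of_real (\<beta> - \<alpha>) * gauss_inner \<alpha> \<beta> (pderiv f) g)"
    by (simp add: algebra_simps)
  finally show ?thesis by (simp only: mult_cancel_left) simp
qed

text \<open>Both constants come from \<open>gauss_inner_pCons_left\<close>. Subtracting
  \<open>(\<beta> - \<alpha>) / (2 \<alpha> \<beta>)\<close> times the derivative from
  \<open>pCons 0 f\<close> cancels the derivative on \<open>f\<close>, and what remains is the
  product of \<open>f\<close> with \<open>pderiv g\<close>, divided by
  \<open>gauss_kappa\<close>.\<close>

definition gauss_kappa :: real where "gauss_kappa = 2 * \<alpha> * \<beta> / (\<alpha> + \<beta>)"
definition gauss_herm :: "nat \<Rightarrow> complex poly" where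
  "gauss_herm = herm (of_real ((\<beta> - \<alpha>) / (2 * \<alpha> * \<beta>)))"

lemma gauss_inner_herm_Suc:
  "gauss_inner \<alpha> \<beta> (gauss_herm (Suc k)) g = gauss_inner \<alpha> \<beta> (gauss_herm k) (pderiv g) / of_real gauss_kappa"
proof -
  have "gauss_inner \<alpha> \<beta> (gauss_herm (Suc k)) g = gauss_inner \<alpha> \<beta> (pCons 0 (gauss_herm k)) g
      - of_real ((\<beta> - \<alpha>) / (2 * \<alpha> * \<beta>)) * gauss_inner \<alpha> \<beta> (pderiv (gauss_herm k)) g"
    by (simp add: gauss_herm_def gauss_inner_diff_left gauss_inner_smult_left)
  also have "\<dots> = of_real ((\<alpha> + \<beta>) / (2 * \<alpha> * \<beta>)) * gauss_inner \<alpha> \<beta> (gauss_herm k) (pderiv g)"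
  proof -
    have "of_real (2 * \<alpha> * \<beta>) \<noteq> (0 :: complex)" using pos by simp
    thus ?thesis
      using gauss_inner_pCons_left[of "gauss_herm k" g] unfolding of_real_divide
      by (simp add: divide_simps del: of_real_mult of_real_add of_real_diff) (simp add: mult.commute del: of_real_mult of_real_add of_real_diff)
  qed
  finally show ?thesis using pos by (simp add: gauss_kappa_def)
qed

text \<open>Each lowering of the Hermite index differentiates \<open>g\<close> once, and k
  derivatives kill a polynomial of degree below k. The hypothesis is put on coefficients, so that at
  \<open>k = 0\<close> it means \<open>g = 0\<close>.\<close>

lemma gauss_inner_herm_low:
  "(\<And>i. i \<ge> k \<Longrightarrow> coeff g i = 0) \<Longrightarrow> gauss_inner \<alpha> \<beta> (gauss_herm k) g = 0"
proof (induction k arbitrary: g)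
  case 0
  hence "g = 0" by (intro poly_eqI) simp
  thus ?case by simp
next
  case (Suc k)
  thus ?case by (simp add: gauss_inner_herm_Suc coeff_pderiv del: of_nat_Suc)
qed

text \<open>The total mass of the weight is \<open>pi / sqrt (\<alpha> \<beta>)\<close>, and the
  step from k to k + 1 contributes \<open>(k + 1) / gauss_kappa\<close>.\<close>

definition gauss_norm_sq :: "nat \<Rightarrow> real" where
  "gauss_norm_sq k = fact k * pi / (sqrt (\<alpha> * \<beta>) * gauss_kappa ^ k)"

lemma gauss_norm_sq_pos: "gauss_norm_sq k > 0"
  using pos by (simp add: gauss_norm_sq_def gauss_kappa_def)

lemma gauss_inner_herm_same:
  "gauss_inner \<alpha> \<beta> (gauss_herm k) (gauss_herm k) = of_real (gauss_norm_sq k)"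
proof (induction k)
  case 0
  show ?case by (simp add: gauss_herm_def gauss_inner_1_1 gauss_norm_sq_def)
next
  case (Suc k)
  have "pderiv (gauss_herm (Suc k)) = smult (of_nat (Suc k)) (gauss_herm k)"
    by (simp only: gauss_herm_def pderiv_herm_Suc)
  thus ?case
    using Suc by (simp add: gauss_inner_herm_Suc gauss_inner_smult_right gauss_norm_sq_def mult_ac)
qed

lemma gauss_inner_herm:
  "gauss_inner \<alpha> \<beta> (gauss_herm k) (gauss_herm l) = (if k = l then of_real (gauss_norm_sq k) else 0)"
proof -
  have *: "gauss_inner \<alpha> \<beta> (gauss_herm k) (gauss_herm l) = 0" if "l < k" for k l
    using that by (intro gauss_inner_herm_low coeff_eq_0) (simp add: gauss_herm_def degree_herm)
  show ?thesis
    using *[of l k] *[of k l] gauss_inner_herm_same[of k] gauss_inner_cnj[of "gauss_herm l" "gauss_herm k"]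
    by (cases k l rule: linorder_cases) auto
qed

section \<open>Existence and uniqueness of the orthonormal family\<close>

definition gauss_orthonormal :: "(nat \<Rightarrow> complex poly) \<Rightarrow> bool" where
  "gauss_orthonormal p \<longleftrightarrow>
    (\<forall>k. degree (p k) = k \<and> lead_coeff (p k) \<in> \<real> \<and> 0 < Re (lead_coeff (p k))) \<and>
    (\<forall>k l. gauss_inner \<alpha> \<beta> (p k) (p l) = (if k = l then 1 else 0))"

definition gauss_herm_normalized :: "nat \<Rightarrow> complex poly" where
  "gauss_herm_normalized k = smult (of_real (1 / sqrt (gauss_norm_sq k))) (gauss_herm k)"

lemma gauss_orthonormal_herm: "gauss_orthonormal gauss_herm_normalized"
  unfolding gauss_orthonormal_def
proof (intro conjI allI)
  fix k l
  have nz: "sqrt (gauss_norm_sq k) \<noteq> 0" "sqrt (gauss_norm_sq k) > 0" using gauss_norm_sq_pos[of k] by auto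
  show "degree (gauss_herm_normalized k) = k"
    using nz by (simp add: gauss_herm_normalized_def gauss_herm_def degree_herm)
  show "lead_coeff (gauss_herm_normalized k) \<in> \<real>" "0 < Re (lead_coeff (gauss_herm_normalized k))"
    using nz lead_coeff_herm by (simp_all add: gauss_herm_normalized_def gauss_herm_def lead_coeff_smult del: of_real_divide)
  have "sqrt (gauss_norm_sq k) * sqrt (gauss_norm_sq k) = gauss_norm_sq k"
    using gauss_norm_sq_pos[of k] by simp
  hence "complex_of_real (sqrt (gauss_norm_sq k)) * of_real (sqrt (gauss_norm_sq k)) = of_real (gauss_norm_sq k)"
    by (metis of_real_mult)
  thus "gauss_inner \<alpha> \<beta> (gauss_herm_normalized k) (gauss_herm_normalized l) = (if k = l then 1 else 0)"
    using nz by (auto simp: gauss_herm_normalized_def gauss_inner_smult_left gauss_inner_smult_right gauss_inner_herm divide_simps)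
qed

text \<open>The polynomials \<open>p 0\<close>, ..., \<open>p (m - 1)\<close> have exact degrees and
  so span everything of degree below m. The induction removes one leading term at a time, with the
  bound m kept separate from the fixed index k.\<close>

lemma gauss_orthonormal_low:
  assumes "gauss_orthonormal p" and "\<And>i. i \<ge> k \<Longrightarrow> coeff g i = 0"
  shows "gauss_inner \<alpha> \<beta> (p k) g = 0"
proof -
  have "m \<le> k \<Longrightarrow> (\<And>i. i \<ge> m \<Longrightarrow> coeff g i = 0) \<Longrightarrow> gauss_inner \<alpha> \<beta> (p k) g = 0" for m
  proof (induction m arbitrary: g)
    case 0
    hence "g = 0" by (intro poly_eqI) simp
    thus ?case by simp
  next
    case (Suc m)
    define a where "a = coeff g m / lead_coeff (p m)"
    have deg: "degree (p m) = m" and lc: "lead_coeff (p m) \<noteq> 0"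
      using assms(1) unfolding gauss_orthonormal_def by (force, metis zero_complex.simps(1) less_irrefl)
    have "coeff (g - smult a (p m)) i = 0" if "i \<ge> m" for i
      using that Suc.prems(2)[of i] lc deg coeff_eq_0[of "p m" i]
      by (cases "i = m") (auto simp: a_def)
    hence "gauss_inner \<alpha> \<beta> (p k) (g - smult a (p m)) = 0"
      using Suc.IH Suc.prems(1) by simp
    moreover have "gauss_inner \<alpha> \<beta> (p k) (p m) = 0"
      using assms(1) Suc.prems(1) unfolding gauss_orthonormal_def by simp
    ultimately show ?case
      by (simp add: gauss_inner_diff_right gauss_inner_smult_right)
  qed
  from this[of k] show ?thesis using assms(2) by simp
qed

text \<open>After matching leading coefficients, \<open>d = p k - a q k\<close> has degree below k
  and is orthogonal to every \<open>p l\<close> with l < k, which forces \<open>d = 0\<close>: its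
  leading term would have a nonzero component along \<open>p m\<close>, where m is its degree. Then
  \<open>a\<close> is a positive real of modulus 1.\<close>

lemma gauss_orthonormal_unique:
  assumes p: "gauss_orthonormal p" and q: "gauss_orthonormal q"
  shows "p = q"
proof
  fix k
  have deg: "degree (p j) = j" "degree (q j) = j" for j
    using p q unfolding gauss_orthonormal_def by auto
  have lc: "lead_coeff (p j) \<in> \<real>" "Re (lead_coeff (p j)) > 0"
    "lead_coeff (q j) \<in> \<real>" "Re (lead_coeff (q j)) > 0" for j
    using p q unfolding gauss_orthonormal_def by blast+
  define a where "a = lead_coeff (p k) / lead_coeff (q k)"
  have nz: "lead_coeff (q k) \<noteq> 0" using lc(4)[of k] by auto
  define d where "d = p k - smult a (q k)"
  have low: "coeff d i = 0" if "i \<ge> k" for i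
    using that nz deg coeff_eq_0[of "p k" i] coeff_eq_0[of "q k" i]
    by (cases "i = k") (auto simp: d_def a_def)
  have orth: "gauss_inner \<alpha> \<beta> (p l) d = 0" if "l < k" for l
  proof -
    have "gauss_inner \<alpha> \<beta> (p k) (p l) = 0" "gauss_inner \<alpha> \<beta> (q k) (p l) = 0"
      using that by (auto intro!: gauss_orthonormal_low p q coeff_eq_0 simp: deg)
    hence "gauss_inner \<alpha> \<beta> d (p l) = 0"
      by (simp add: d_def gauss_inner_diff_left gauss_inner_smult_left)
    thus ?thesis by (metis gauss_inner_cnj complex_cnj_zero)
  qed
  have "d = 0"
  proof (rule ccontr)
    assume "d \<noteq> 0"
    define m where "m = degree d"
    have m: "coeff d m \<noteq> 0" using \<open>d \<noteq> 0\<close> by (simp add: m_def)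
    hence "m < k" using low by (meson not_le)
    define b where "b = coeff d m / lead_coeff (p m)"
    have pm: "lead_coeff (p m) \<noteq> 0" using lc(2)[of m] by auto
    have "coeff (d - smult b (p m)) i = 0" if "i \<ge> m" for i
      using that pm deg coeff_eq_0[of "p m" i] coeff_eq_0[of d i]
      by (cases "i = m") (auto simp: b_def m_def[symmetric])
    hence "gauss_inner \<alpha> \<beta> (p m) (d - smult b (p m)) = 0"
      by (intro gauss_orthonormal_low p)
    moreover have "gauss_inner \<alpha> \<beta> (p m) (p m) = 1"
      using p unfolding gauss_orthonormal_def by simp
    ultimately have "b = 0"
      using orth[OF \<open>m < k\<close>] by (simp add: gauss_inner_diff_right gauss_inner_smult_right)
    thus False using m pm by (simp add: b_def)
  qed
  hence pk: "p k = smult a (q k)" by (simp add: d_def)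
  have a: "a \<in> \<real>" unfolding a_def using lc by (intro Reals_divide)
  have "Re a > 0"
    using lc[of k] unfolding a_def by (elim Reals_cases) (simp del: of_real_divide add: of_real_divide[symmetric])
  moreover have "cnj a * a = 1"
  proof -
    have "gauss_inner \<alpha> \<beta> (p k) (p k) = 1" "gauss_inner \<alpha> \<beta> (q k) (q k) = 1"
      using p q unfolding gauss_orthonormal_def by auto
    thus ?thesis by (simp add: pk gauss_inner_smult_left gauss_inner_smult_right mult.commute)
  qed
  ultimately have "a = 1"
    using a by (elim Reals_cases) (auto simp: of_real_mult[symmetric] simp del: of_real_mult simp: square_eq_1_iff)
  thus "p k = q k" using pk by simp
qed


end

section \<open>The density as a distribution function\<close>

lemma elliptic_potential_eq:
  "elliptic_potential t z = (1 - t) * (Re z)\<^sup>2 + (1 + t) * (Im z)\<^sup>2"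
  unfolding elliptic_potential_def cmod_power2 by (simp add: power2_eq_square algebra_simps)

text \<open>
  The law of \<open>X\<close>: for \<open>n > 0\<close>, \<open>edge_weight t n z k\<close> is \<open>\<pi>\<close> times the \<open>k\<close>-th term of the
  eigenvalue density at \<open>z\<close>, for all \<open>k\<close> rather than only \<open>k < n\<close>.
\<close>
definition edge_weight :: "real \<Rightarrow> nat \<Rightarrow> complex \<Rightarrow> nat \<Rightarrow> real" where
  "edge_weight t n z k = sqrt (1 - t\<^sup>2) * exp (- (real n * elliptic_potential t z)) *
     ((real n * (1 - t\<^sup>2)) ^ k / fact k *
      (cmod (poly (herm (of_real (t / (real n * (1 - t\<^sup>2)))) k) z))\<^sup>2)"

lemma eigenvalue_density_eq:
  assumes t: "0 < t" "t < 1" and n: "n > 0"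
  shows "eigenvalue_density (elliptic_potential t) n z = (\<Sum>k<n. edge_weight t n z k) / pi"
proof -
  \<comment> \<open>In the coordinates Re z and Im z the potential is diagonal, and these are the
    rates for which \<open>gauss_weight\<close> becomes \<open>exp (- n V)\<close>.\<close>
  define \<alpha> where "\<alpha> = real n * (1 - t)"
  define \<beta> where "\<beta> = real n * (1 + t)"
  have pos: "\<alpha> > 0" "\<beta> > 0" using t n by (auto simp: \<alpha>_def \<beta>_def)
  have t2: "1 - t\<^sup>2 > 0" using t by (simp add: power_less_one_iff)
  have ab: "\<alpha> * \<beta> = (real n)\<^sup>2 * (1 - t\<^sup>2)"
    by (simp add: \<alpha>_def \<beta>_def power2_eq_square algebra_simps)
  have \<kappa>: "gauss_kappa \<alpha> \<beta> = real n * (1 - t\<^sup>2)"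
  proof -
    have "\<alpha> + \<beta> = 2 * real n" by (simp add: \<alpha>_def \<beta>_def algebra_simps)
    thus ?thesis unfolding gauss_kappa_def[OF pos] mult.assoc ab using n by (simp add: power2_eq_square)
  qed
  have c: "(\<beta> - \<alpha>) / (2 * \<alpha> * \<beta>) = t / (real n * (1 - t\<^sup>2))"
  proof -
    have "\<beta> - \<alpha> = 2 * real n * t" by (simp add: \<alpha>_def \<beta>_def algebra_simps)
    thus ?thesis unfolding mult.assoc[of 2] ab using n by (simp add: power2_eq_square)
  qed
  have w: "complex_of_real (exp (- real n * elliptic_potential t z)) = gauss_weight \<alpha> \<beta> z" for z
    by (simp add: gauss_weight_def elliptic_potential_eq \<alpha>_def \<beta>_def exp_add[symmetric] algebra_simps
        flip: of_real_mult)
  have iff: "is_orthonormal_polys (elliptic_potential t) n p \<longleftrightarrow> gauss_orthonormal \<alpha> \<beta> p" for p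
    unfolding is_orthonormal_polys_def gauss_orthonormal_def[OF pos] gauss_inner_def w ..
  have "orthonormal_polys (elliptic_potential t) n = gauss_herm_normalized \<alpha> \<beta>"
    unfolding orthonormal_polys_def iff
    using gauss_orthonormal_herm[OF pos] gauss_orthonormal_unique[OF pos] by blast
  hence "eigenvalue_density (elliptic_potential t) n z =
     1 / real n * exp (- real n * elliptic_potential t z) * (\<Sum>k<n. (cmod (poly (gauss_herm_normalized \<alpha> \<beta> k) z))\<^sup>2)"
    by (simp add: eigenvalue_density_def)
  also have "\<dots> = (\<Sum>k<n. edge_weight t n z k / pi)"
    unfolding sum_distrib_left
  proof (rule sum.cong)
    fix k
    have "(cmod (poly (gauss_herm_normalized \<alpha> \<beta> k) z))\<^sup>2 =
       (cmod (poly (gauss_herm \<alpha> \<beta> k) z))\<^sup>2 / gauss_norm_sq \<alpha> \<beta> k"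
      using gauss_norm_sq_pos[OF pos, of k]
      by (simp add: gauss_herm_normalized_def[OF pos] norm_mult norm_divide power_divide)
    moreover have "gauss_norm_sq \<alpha> \<beta> k = fact k * pi / (real n * sqrt (1 - t\<^sup>2) * (real n * (1 - t\<^sup>2)) ^ k)"
      by (simp add: gauss_norm_sq_def[OF pos] \<kappa> ab real_sqrt_mult)
    ultimately show "1 / real n * exp (- real n * elliptic_potential t z) * (cmod (poly (gauss_herm_normalized \<alpha> \<beta> k) z))\<^sup>2 =
        edge_weight t n z k / pi"
      using n by (simp add: edge_weight_def gauss_herm_def[OF pos] c)
  qed simp
  finally show ?thesis by (simp add: sum_divide_distrib)
qed

text \<open>Mehler's closed form combined with the factor \<open>exp (- n V)\<close>. Pulling out
  \<open>s - 1\<close> makes the value at s = 1 visible at once and leaves a bracket which, at s =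
  1, is the quadratic form of the ellipse.\<close>

definition edge_gf :: "real \<Rightarrow> nat \<Rightarrow> complex \<Rightarrow> complex \<Rightarrow> complex" where
  "edge_gf t n z s = of_real (sqrt (1 - t\<^sup>2)) / csqrt (1 - (of_real t * s)\<^sup>2) *
     exp (of_nat n * ((s - 1) * (of_real ((Re z)\<^sup>2 * (1 - t)) / (1 + of_real t * s)
                             + of_real ((Im z)\<^sup>2 * (1 + t)) / (1 - of_real t * s))))"

text \<open>Mehler's formula with \<open>w = cnj z\<close>, \<open>c = t / \<kappa>\<close> and
  \<open>r = \<kappa> s\<close>, where \<open>\<kappa> = n (1 - t^2)\<close>. Then
  \<open>c r = t s\<close>, so t < 1 gives convergence on the closed unit disc, boundary
  included.\<close>

lemma edge_weight_sums:
  assumes t: "0 < t" "t < 1" and n: "n > 0" and s: "norm s \<le> 1"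
  shows "(\<lambda>k. of_real (edge_weight t n z k) * s ^ k) sums edge_gf t n z s"
proof -
  have t2: "1 - t\<^sup>2 > 0" using t by (simp add: power_less_one_iff)
  define \<kappa> where "\<kappa> = real n * (1 - t\<^sup>2)"
  have \<kappa>: "\<kappa> > 0" using t2 n by (simp add: \<kappa>_def)
  define c where "c = t / \<kappa>"
  define T where "T = complex_of_real t"
  define X where "X = complex_of_real (Re z)"
  define Y where "Y = complex_of_real (Im z)"
  define K where "K = complex_of_real \<kappa>"
  have K: "K = of_nat n * (1 - T\<^sup>2)" by (simp add: K_def \<kappa>_def T_def)
  have K0: "K \<noteq> 0" using \<kappa> by (simp add: K_def)
  have cr: "of_real c * (K * s) = T * s" using \<kappa> by (simp add: c_def T_def K_def)
  have Ts: "norm (T * s) < 1"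
  proof -
    have "t * norm s \<le> t" by (rule mult_left_le) (use s t in auto)
    from le_less_trans[OF this t(2)] show ?thesis using t by (simp add: norm_mult T_def)
  qed
  have nz: "1 + T * s \<noteq> 0" "1 - T * s \<noteq> 0"
  proof -
    have "1 + T * s = 0 \<Longrightarrow> norm (T * s) = 1"
      by (metis add_eq_0_iff norm_minus_cancel norm_one)
    thus "1 + T * s \<noteq> 0" using Ts by auto
    show "1 - T * s \<noteq> 0" using Ts by auto
  qed
  have sq: "1 - (T * s)\<^sup>2 = (1 + T * s) * (1 - T * s)"
    by (simp add: power2_eq_square algebra_simps)
  have z: "z = X + \<i> * Y" "cnj z = X - \<i> * Y"
    by (simp_all add: X_def Y_def complex_eq_iff)
  have V: "complex_of_real (elliptic_potential t z) = (1 - T) * X\<^sup>2 + (1 + T) * Y\<^sup>2"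
    by (simp add: elliptic_potential_eq T_def X_def Y_def)
  have "(\<lambda>k. poly (herm (of_real c) k) z * poly (herm (of_real c) k) (cnj z) / fact k * (K * s) ^ k) sums
    (exp ((K * s * z * cnj z - of_real c * (K * s)\<^sup>2 * (z\<^sup>2 + (cnj z)\<^sup>2) / 2) / (1 - (of_real c * (K * s))\<^sup>2))
       / csqrt (1 - (of_real c * (K * s))\<^sup>2))"
    by (rule mehler_sums) (simp add: cr Ts del: norm_mult)
  hence "(\<lambda>k. of_real (sqrt (1 - t\<^sup>2) * exp (- (real n * elliptic_potential t z))) *
      (poly (herm (of_real c) k) z * poly (herm (of_real c) k) (cnj z) / fact k * (K * s) ^ k)) sums
    (of_real (sqrt (1 - t\<^sup>2) * exp (- (real n * elliptic_potential t z))) *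
     (exp ((K * s * z * cnj z - of_real c * (K * s)\<^sup>2 * (z\<^sup>2 + (cnj z)\<^sup>2) / 2) / (1 - (T * s)\<^sup>2))
       / csqrt (1 - (T * s)\<^sup>2)))"
    unfolding cr by (rule sums_mult)
  also have "(\<lambda>k. of_real (sqrt (1 - t\<^sup>2) * exp (- (real n * elliptic_potential t z))) *
      (poly (herm (of_real c) k) z * poly (herm (of_real c) k) (cnj z) / fact k * (K * s) ^ k)) =
     (\<lambda>k. of_real (edge_weight t n z k) * s ^ k)"
  proof
    fix k
    have "poly (herm (of_real c) k) z * poly (herm (of_real c) k) (cnj z) =
        of_real ((cmod (poly (herm (of_real c) k) z))\<^sup>2)"
      by (simp only: complex_norm_square cnj_poly_herm)
    thus "of_real (sqrt (1 - t\<^sup>2) * exp (- (real n * elliptic_potential t z))) *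
      (poly (herm (of_real c) k) z * poly (herm (of_real c) k) (cnj z) / fact k * (K * s) ^ k) =
      of_real (edge_weight t n z k) * s ^ k"
      unfolding edge_weight_def \<kappa>_def[symmetric] c_def[symmetric]
      by (simp add: K_def power_mult_distrib)
  qed
  also have "(K * s * z * cnj z - of_real c * (K * s)\<^sup>2 * (z\<^sup>2 + (cnj z)\<^sup>2) / 2) =
      of_nat n * (1 - T\<^sup>2) * s * ((1 - T * s) * X\<^sup>2 + (1 + T * s) * Y\<^sup>2)"
  proof -
    have 1: "z * cnj z = X\<^sup>2 + Y\<^sup>2" "(z\<^sup>2 + (cnj z)\<^sup>2) / 2 = X\<^sup>2 - Y\<^sup>2"
      by (simp_all add: z(1) power2_eq_square algebra_simps) (simp_all add: X_def Y_def field_simps)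
    have "K * s * z * cnj z - of_real c * (K * s)\<^sup>2 * (z\<^sup>2 + (cnj z)\<^sup>2) / 2 =
        K * s * (z * cnj z) - (of_real c * (K * s)) * (K * s) * ((z\<^sup>2 + (cnj z)\<^sup>2) / 2)"
      by (simp add: power2_eq_square)
    also have "\<dots> = K * s * (X\<^sup>2 + Y\<^sup>2) - (T * s) * (K * s) * (X\<^sup>2 - Y\<^sup>2)"
      by (simp only: cr 1)
    also have "\<dots> = of_nat n * (1 - T\<^sup>2) * s * ((1 - T * s) * X\<^sup>2 + (1 + T * s) * Y\<^sup>2)"
      unfolding K by (simp add: algebra_simps)
    finally show ?thesis .
  qed
  also have "of_real (sqrt (1 - t\<^sup>2) * exp (- (real n * elliptic_potential t z))) *
      (exp (of_nat n * (1 - T\<^sup>2) * s * ((1 - T * s) * X\<^sup>2 + (1 + T * s) * Y\<^sup>2) / (1 - (T * s)\<^sup>2))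
       / csqrt (1 - (T * s)\<^sup>2)) = edge_gf t n z s"
  proof -
    \<comment> \<open>Partial fractions. For the \<open>X\<close> part, \<open>(1 - T^2) s / (1 + T
      s) - (1 - T) = (1 - T) (s - 1) / (1 + T s)\<close>; the \<open>Y\<close> part is the same with
      T replaced by -T.\<close>
    have "of_nat n * (1 - T\<^sup>2) * s * ((1 - T * s) * X\<^sup>2 + (1 + T * s) * Y\<^sup>2) / (1 - (T * s)\<^sup>2)
        - of_nat n * ((1 - T) * X\<^sup>2 + (1 + T) * Y\<^sup>2) =
      of_nat n * ((s - 1) * (X\<^sup>2 * (1 - T) / (1 + T * s) + Y\<^sup>2 * (1 + T) / (1 - T * s)))"
      unfolding sq using nz by (simp add: divide_simps) algebra
    hence "exp (of_nat n * (1 - T\<^sup>2) * s * ((1 - T * s) * X\<^sup>2 + (1 + T * s) * Y\<^sup>2) / (1 - (T * s)\<^sup>2))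
        * exp (- (of_nat n * complex_of_real (elliptic_potential t z))) =
      exp (of_nat n * ((s - 1) * (X\<^sup>2 * (1 - T) / (1 + T * s) + Y\<^sup>2 * (1 + T) / (1 - T * s))))"
      unfolding V by (simp add: exp_add[symmetric])
    moreover have "complex_of_real (exp (- (real n * elliptic_potential t z))) =
       exp (- (of_nat n * complex_of_real (elliptic_potential t z)))"
      by (simp flip: exp_of_real)
    ultimately show ?thesis
      by (simp add: edge_gf_def T_def X_def Y_def mult_ac)
  qed
  finally show ?thesis .
qed

lemma edge_weight_nonneg: "0 < t \<Longrightarrow> t < 1 \<Longrightarrow> 0 \<le> edge_weight t n z k"
  by (simp add: edge_weight_def abs_square_le_1)

lemma edge_weight_sums_1:
  assumes t: "0 < t" "t < 1" and n: "n > 0"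
  shows "edge_weight t n z sums 1"
proof -
  have t2: "1 - t\<^sup>2 > 0" using t by (simp add: power_less_one_iff)
  have "csqrt (1 - (of_real t)\<^sup>2) = of_real (sqrt (1 - t\<^sup>2))"
    using csqrt_of_real_nonneg[of "1 - t\<^sup>2"] t2 by simp
  hence "edge_gf t n z 1 = 1" using t2 by (simp add: edge_gf_def)
  with edge_weight_sums[OF t n, of 1 z]
  have "(\<lambda>k. complex_of_real (edge_weight t n z k)) sums of_real 1" by simp
  thus ?thesis by (simp only: sums_of_real_iff)
qed

definition edge_pmf :: "real \<Rightarrow> nat \<Rightarrow> complex \<Rightarrow> nat pmf" where
  "edge_pmf t n z = embed_pmf (edge_weight t n z)"

lemma pmf_edge_pmf:
  assumes t: "0 < t" "t < 1" and n: "n > 0"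
  shows "pmf (edge_pmf t n z) k = edge_weight t n z k"
  unfolding edge_pmf_def
proof (rule pmf_embed_pmf)
  show "0 \<le> edge_weight t n z k" for k by (rule edge_weight_nonneg[OF t])
  have "(\<Sum>k. ennreal (edge_weight t n z k)) = ennreal 1"
    by (rule suminf_ennreal_eq[OF edge_weight_nonneg[OF t] edge_weight_sums_1[OF t n]])
  thus "(\<integral>\<^sup>+ k. ennreal (edge_weight t n z k) \<partial>count_space UNIV) = 1"
    by (simp add: nn_integral_count_space_nat)
qed

text \<open>Used with f(k) of modulus 1, to read a characteristic function as a generating function
  on the unit circle.\<close>

lemma pmf_nat_sums_integral:
  fixes f :: "nat \<Rightarrow> complex"
  assumes "\<And>k. norm (f k) \<le> B"
  shows "(\<lambda>k. of_real (pmf p k) * f k) sums (\<integral>k. f k \<partial>measure_pmf p)"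
proof -
  have "integrable (measure_pmf p) f"
    by (rule measure_pmf.integrable_const_bound[where B = B]) (use assms in auto)
  hence "integrable (count_space UNIV) (\<lambda>k. pmf p k *\<^sub>R f k)"
    unfolding measure_pmf_eq_density by (subst (asm) integrable_density) auto
  hence "(\<lambda>k. pmf p k *\<^sub>R f k) sums (\<integral>k. pmf p k *\<^sub>R f k \<partial>count_space UNIV)"
    by (rule sums_integral_count_space_nat)
  also have "(\<integral>k. pmf p k *\<^sub>R f k \<partial>count_space UNIV) = (\<integral>k. f k \<partial>measure_pmf p)"
    unfolding measure_pmf_eq_density by (subst integral_density) auto
  finally show ?thesis by (simp add: scaleR_conv_of_real)
qed

section \<open>The limit at the edge\<close>

text \<open>(A, B) is the outward normal \<open>(x / a_t^2, y / b_t^2)\<close>, half the gradient of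
  the quadratic form at the point. Its slope \<open>B / A\<close> is
  \<open>(1 + t) / (1 - t) * tan \<phi>\<close>, and the branches of \<open>normal_angle\<close>
  supply the sign that \<open>arctan\<close> loses.\<close>

lemma normal_angle_cos_sin:
  fixes t \<phi> :: real
  assumes t: "0 < t" "t < 1" and \<phi>: "- pi < \<phi>" "\<phi> \<le> pi"
  defines "A \<equiv> sqrt ((1 - t) / (1 + t)) * cos \<phi>" and "B \<equiv> sqrt ((1 + t) / (1 - t)) * sin \<phi>"
  shows "sqrt (A\<^sup>2 + B\<^sup>2) > 0"
    and "sqrt (A\<^sup>2 + B\<^sup>2) * cos (normal_angle t \<phi>) = A"
    and "sqrt (A\<^sup>2 + B\<^sup>2) * sin (normal_angle t \<phi>) = B"
proof -
  define u where "u = (1 + t) / (1 - t) * tan \<phi>"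
  define \<sigma> where "\<sigma> = sqrt (A\<^sup>2 + B\<^sup>2)"
  have r: "sqrt ((1 - t) / (1 + t)) > 0" "sqrt ((1 + t) / (1 - t)) > 0" using t by auto
  have AB: "A \<noteq> 0 \<or> B \<noteq> 0"
    using r sin_zero_abs_cos_one[of \<phi>] unfolding A_def B_def by auto
  thus \<sigma>: "sqrt (A\<^sup>2 + B\<^sup>2) > 0"
    by (simp add: sum_power2_gt_zero_iff)
  have sA: "sgn A = sgn (cos \<phi>)" using r(1) by (simp add: A_def sgn_mult)
  \<comment> \<open>\<open>arctan\<close> always points into the right half-plane, so it gives (A,
    B) up to the sign of A; when A is negative a half turn by pi corrects both coordinates.\<close>
  have arctan: "\<sigma> * cos (arctan u) = \<bar>A\<bar>" "\<sigma> * sin (arctan u) = sgn A * B" if "cos \<phi> \<noteq> 0"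
  proof -
    have A0: "A \<noteq> 0" using t that by (simp add: A_def)
    have "sqrt ((1 + t) / (1 - t)) = (1 + t) / (1 - t) * sqrt ((1 - t) / (1 + t))"
    proof -
      have "(1 + t) / (1 - t) = sqrt (((1 + t) / (1 - t))\<^sup>2)" using t by simp
      hence "(1 + t) / (1 - t) * sqrt ((1 - t) / (1 + t)) = sqrt (((1 + t) / (1 - t))\<^sup>2 * ((1 - t) / (1 + t)))"
        by (simp only: real_sqrt_mult)
      also have "((1 + t) / (1 - t))\<^sup>2 * ((1 - t) / (1 + t)) = (1 + t) / (1 - t)"
        using t by (simp add: power2_eq_square)
      finally show ?thesis by simp
    qed
    hence B: "B = u * A" using that by (simp add: B_def A_def u_def tan_def)
    have "\<sigma> = sqrt (A\<^sup>2 * (1 + u\<^sup>2))"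
      by (simp add: \<sigma>_def B algebra_simps power_mult_distrib)
    hence "\<sigma> = \<bar>A\<bar> * sqrt (1 + u\<^sup>2)" by (simp add: real_sqrt_mult)
    moreover have "sqrt (1 + u\<^sup>2) > 0" by (simp add: add_pos_nonneg)
    ultimately show "\<sigma> * cos (arctan u) = \<bar>A\<bar>" "\<sigma> * sin (arctan u) = sgn A * B"
      by (simp_all add: cos_arctan sin_arctan B abs_sgn)
  qed
  have "\<sigma> * cos (normal_angle t \<phi>) = A \<and> \<sigma> * sin (normal_angle t \<phi>) = B"
  proof -
    consider "\<phi> \<in> {- pi / 2 <..< pi / 2}" | "\<phi> < - pi / 2" | "\<phi> > pi / 2" | "\<phi> = pi / 2" | "\<phi> = - pi / 2"
      by fastforce
    thus ?thesis
    proof cases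
      case 1
      hence c: "cos \<phi> > 0" by (intro cos_gt_zero_pi) auto
      hence "A > 0" using r unfolding A_def by (intro mult_pos_pos)
      thus ?thesis using 1 arctan c by (simp add: normal_angle_def u_def)
    next
      case 2
      have "cos (\<phi> + pi) > 0" using 2 \<phi> by (intro cos_gt_zero_pi) auto
      hence c: "cos \<phi> < 0" by simp
      hence "A < 0" using r unfolding A_def by (intro mult_pos_neg)
      moreover have "\<phi> < 0" using 2 pi_gt_zero by linarith
      hence "normal_angle t \<phi> = arctan u - pi"
        using 2 by (simp add: normal_angle_def u_def)
      ultimately show ?thesis using arctan c by simp
    next
      case 3
      have "cos (\<phi> - pi) > 0" using 3 \<phi> by (intro cos_gt_zero_pi) auto
      hence c: "cos \<phi> < 0" by simp
      hence "A < 0" using r unfolding A_def by (intro mult_pos_neg)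
      moreover have "\<phi> > 0" using 3 pi_gt_zero by linarith
      hence "normal_angle t \<phi> = arctan u + pi"
        using 3 by (simp add: normal_angle_def u_def)
      ultimately show ?thesis using arctan c by simp
    next
      case 4
      hence cs: "cos \<phi> = 0" "sin \<phi> = 1" by (simp_all only: cos_pi_half sin_pi_half)
      hence "A = 0" "B > 0" using r(2) unfolding A_def B_def cs by simp_all
      moreover have "normal_angle t \<phi> = \<phi>" unfolding normal_angle_def 4 by simp
      ultimately show ?thesis by (simp add: cs \<sigma>_def)
    next
      case 5
      hence "\<phi> = - (pi / 2)" by simp
      hence cs: "cos \<phi> = 0" "sin \<phi> = -1" by (simp_all only: cos_minus sin_minus cos_pi_half sin_pi_half)
      hence "A = 0" "B < 0" using r(2) unfolding A_def B_def cs by simp_all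
      moreover have "normal_angle t \<phi> = \<phi>" unfolding normal_angle_def 5 by simp
      ultimately show ?thesis by (simp add: cs \<sigma>_def)
    qed
  qed
  thus "sqrt (A\<^sup>2 + B\<^sup>2) * cos (normal_angle t \<phi>) = A" "sqrt (A\<^sup>2 + B\<^sup>2) * sin (normal_angle t \<phi>) = B"
    by (auto simp: \<sigma>_def)
qed

text \<open>The substitution \<open>u = - sqrt 2 * w\<close> turns the Gaussian left tail below -2x
  into the right tail of \<open>exp (- w^2)\<close> beyond \<open>sqrt 2 * x\<close>.\<close>

lemma std_normal_distribution_lessThan:
  "measure std_normal_distribution {..<- (2 * x)} = erfc (sqrt 2 * x) / 2"
proof -
  have "measure std_normal_distribution {..<- (2 * x)} =
      (\<integral>u. indicator {..<- (2 * x)} u * std_normal_density u \<partial>lborel)"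
  proof -
    have "measure std_normal_distribution {..<- (2 * x)} =
        (\<integral>u. indicator {..<- (2 * x)} u \<partial>std_normal_distribution)"
      by simp
    also have "\<dots> = (\<integral>u. std_normal_density u *\<^sub>R indicator {..<- (2 * x)} u \<partial>lborel)"
      by (rule integral_density) auto
    finally show ?thesis by (simp add: mult.commute)
  qed
  also have "\<dots> = sqrt 2 * (\<integral>w. indicator {..<- (2 * x)} (0 + (- sqrt 2) * w) *
      std_normal_density (0 + (- sqrt 2) * w) \<partial>lborel)"
    by (subst lborel_integral_real_affine[of "- sqrt 2" _ 0]) simp_all
  also have "(\<integral>w. indicator {..<- (2 * x)} (0 + (- sqrt 2) * w) * std_normal_density (0 + (- sqrt 2) * w) \<partial>lborel) =
      (\<integral>w. 1 / sqrt (2 * pi) * (indicator {sqrt 2 * x..} w *\<^sub>R exp (- w\<^sup>2)) \<partial>lborel)"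
  \<comment> \<open>The open half-line becomes an open half-line, while \<open>erfc\<close>
    integrates over a closed one; they differ in one point.\<close>
  proof (rule integral_cong_AE)
    have s2: "x * 2 = sqrt 2 * (sqrt 2 * x)" by simp
    have "- (sqrt 2 * w) < - (2 * x) \<longleftrightarrow> sqrt 2 * x < w" for w
      using mult_less_cancel_left_pos[of "sqrt 2" "sqrt 2 * x" w] by (simp add: s2 mult.commute)
    hence "indicator {..<- (2 * x)} (0 + (- sqrt 2) * w) = (indicator {sqrt 2 * x..} w :: real)"
      if "w \<noteq> sqrt 2 * x" for w
      using that by (auto simp: indicator_def)
    moreover have "std_normal_density (0 + (- sqrt 2) * w) = 1 / sqrt (2 * pi) * exp (- w\<^sup>2)" for w
      by (simp add: std_normal_density_def power_mult_distrib)
    moreover have "AE w in lborel. w \<noteq> sqrt 2 * x" by (rule AE_lborel_singleton)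
    ultimately show "AE w in lborel. indicator {..<- (2 * x)} (0 + (- sqrt 2) * w) * std_normal_density (0 + (- sqrt 2) * w) =
        1 / sqrt (2 * pi) * (indicator {sqrt 2 * x..} w *\<^sub>R exp (- w\<^sup>2))"
      by (elim eventually_mono) simp
  qed auto
  also have "sqrt 2 * \<dots> = erfc (sqrt 2 * x) / 2"
    unfolding erfc_def set_lebesgue_integral_def integral_mult_right_zero by (simp add: real_sqrt_mult)
  finally show ?thesis .
qed

text \<open>The cubic Taylor remainder is of order \<open>n^(-3/2)\<close>, hence still vanishes
  after multiplication by n.\<close>

lemma LIMSEQ_iexp_second_order:
  "(\<lambda>n. of_nat n * (exp (\<i> * of_real (\<tau> / sqrt (real n))) - 1 - \<i> * of_real (\<tau> / sqrt (real n))))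
     \<longlonglongrightarrow> of_real (- \<tau>\<^sup>2 / 2)"
proof -
  define R where "R = (\<lambda>x. exp (\<i> * of_real x) - 1 - \<i> * of_real x :: complex)"
  have R: "cmod (R x + of_real (x\<^sup>2) / 2) \<le> \<bar>x\<bar> ^ 3 / 6" for x
    using iexp_approx1[of x 2]
    by (simp add: R_def eval_nat_numeral fact_numeral algebra_simps power_mult_distrib)
  have "(\<lambda>n. of_nat n * R (\<tau> / sqrt (real n)) - of_real (- \<tau>\<^sup>2 / 2)) \<longlonglongrightarrow> 0"
  proof (rule Lim_null_comparison)
    show "(\<lambda>n. \<bar>\<tau>\<bar> ^ 3 / 6 * (1 / sqrt (real n))) \<longlonglongrightarrow> 0"
      by (rule tendsto_mult_right_zero) real_asymp
    show "\<forall>\<^sub>F n in sequentially. norm (of_nat n * R (\<tau> / sqrt (real n)) - of_real (- \<tau>\<^sup>2 / 2))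
        \<le> \<bar>\<tau>\<bar> ^ 3 / 6 * (1 / sqrt (real n))"
      using eventually_gt_at_top[of 0]
    proof eventually_elim
      case (elim n)
      have "of_nat n * R (\<tau> / sqrt (real n)) - of_real (- \<tau>\<^sup>2 / 2) =
          of_nat n * (R (\<tau> / sqrt (real n)) + of_real ((\<tau> / sqrt (real n))\<^sup>2) / 2)"
        using elim by (simp add: power_divide field_simps flip: of_real_power)
      hence "norm (of_nat n * R (\<tau> / sqrt (real n)) - of_real (- \<tau>\<^sup>2 / 2)) \<le>
          real n * (\<bar>\<tau> / sqrt (real n)\<bar> ^ 3 / 6)"
        using mult_left_mono[OF R[of "\<tau> / sqrt (real n)"], of "real n"] by (simp only: norm_mult norm_of_nat)
      also have "real n * (\<bar>\<tau> / sqrt (real n)\<bar> ^ 3 / 6) = \<bar>\<tau>\<bar> ^ 3 / 6 * (real n / sqrt (real n) ^ 3)"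
        by (simp add: power_divide abs_divide mult_ac)
      also have "real n / sqrt (real n) ^ 3 = 1 / sqrt (real n)"
        using elim by (simp add: eval_nat_numeral)
      finally show ?case .
    qed
  qed
  thus ?thesis unfolding R_def by (rule LIM_zero_cancel)
qed

text \<open>\<open>ell\<close> makes the drift of order \<open>sqrt n\<close> cancel against the
  centring factor. At the next order the point contributes the mean \<mu>, and the dependence of the
  bracket on s contributes v; the quadratic term of \<open>s - 1\<close> accounts for the 1 in
  \<open>1 + 2 * v\<close>.\<close>

lemma edge_gf_limit:
  fixes t x y \<tau> :: real and b :: complex
  assumes t: "0 < t" "t < 1"
    and ell: "x\<^sup>2 * (1 - t) / (1 + t) + y\<^sup>2 * (1 + t) / (1 - t) = 1"
  defines "v \<equiv> y\<^sup>2 * (1 + t) * t / (1 - t)\<^sup>2 - x\<^sup>2 * (1 - t) * t / (1 + t)\<^sup>2"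
    and "\<mu> \<equiv> 2 * x * Re b * (1 - t) / (1 + t) + 2 * y * Im b * (1 + t) / (1 - t)"
  shows "(\<lambda>n. edge_gf t n (Complex x y + b / of_real (sqrt (real n))) (exp (\<i> * of_real (\<tau> / sqrt (real n))))
            * exp (- \<i> * of_real (\<tau> * sqrt (real n))))
         \<longlonglongrightarrow> exp (\<i> * of_real (\<tau> * \<mu>) - of_real (\<tau>\<^sup>2 * (1 + 2 * v) / 2))"
proof -
  define T where "T = complex_of_real t"
  define X where "X = complex_of_real x"
  define Y where "Y = complex_of_real y"
  define D1 where "D1 = complex_of_real (Re b)"
  define D2 where "D2 = complex_of_real (Im b)"
  \<comment> \<open>The bracket of \<open>edge_gf\<close> as a function of the single small
    parameter \<open>e = 1 / sqrt n\<close>, which moves both the point and s. One derivative at 0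
    then captures both effects.\<close>
  define H where "H = (\<lambda>e. (X + D1 * e)\<^sup>2 * (1 - T) / (1 + T * exp (\<i> * of_real \<tau> * e)) +
     (Y + D2 * e)\<^sup>2 * (1 + T) / (1 - T * exp (\<i> * of_real \<tau> * e)))"
  have nz: "1 + T \<noteq> 0" "1 - T \<noteq> 0"
    using t by (auto simp: T_def complex_eq_iff)
  have H0: "H 0 = 1"
  proof -
    have "H 0 = of_real (x\<^sup>2 * (1 - t) / (1 + t) + y\<^sup>2 * (1 + t) / (1 - t))"
      by (simp add: H_def X_def Y_def T_def)
    thus ?thesis by (simp only: ell of_real_1)
  qed
  define H' where "H' = of_real \<mu> + \<i> * of_real \<tau> * of_real v"
  have H': "(H has_field_derivative H') (at 0)"
  proof -
    have "H' = (2 * X * D1 * (1 - T) * (1 + T) - X\<^sup>2 * (1 - T) * (T * (\<i> * of_real \<tau>))) / ((1 + T) * (1 + T))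
        + (2 * Y * D2 * (1 + T) * (1 - T) - Y\<^sup>2 * (1 + T) * (- (T * (\<i> * of_real \<tau>)))) / ((1 - T) * (1 - T))"
      unfolding H'_def \<mu>_def v_def
      using nz t by (simp add: X_def Y_def T_def[symmetric] D1_def D2_def divide_simps power2_eq_square) (simp add: algebra_simps)
    thus ?thesis
      unfolding H_def using nz by (auto intro!: derivative_eq_intros simp: mult_ac)
  qed
  define e where "e = (\<lambda>n. 1 / sqrt (real n))"
  \<comment> \<open>The punctured filter \<open>at 0\<close> is required because \<open>e\<close>
    will be the denominator of a difference quotient.\<close>
  have e_lim: "filterlim (\<lambda>n. complex_of_real (e n)) (at 0) sequentially"
  proof -
    have "e \<longlonglongrightarrow> 0" unfolding e_def by real_asymp
    hence "(\<lambda>n. complex_of_real (e n)) \<longlonglongrightarrow> 0" by (simp add: tendsto_of_real_iff[of _ 0, simplified])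
    moreover have "eventually (\<lambda>n. complex_of_real (e n) \<noteq> 0) sequentially"
      using eventually_gt_at_top[of 0] by eventually_elim (simp add: e_def)
    ultimately show ?thesis by (simp add: filterlim_at)
  qed
  have L1: "(\<lambda>n. (H (of_real (e n)) - 1) / of_real (e n)) \<longlonglongrightarrow> H'"
    using filterlim_compose[OF H'[unfolded DERIV_def] e_lim] by (simp add: H0)
  have L2: "(\<lambda>n. H (of_real (e n))) \<longlonglongrightarrow> 1"
  proof -
    have "isCont H 0" using H' by (rule DERIV_isCont)
    from filterlim_compose[OF this[unfolded isCont_def] e_lim] show ?thesis by (simp add: H0)
  qed
  define S where "S = (\<lambda>n. exp (\<i> * of_real \<tau> * of_real (e n)) :: complex)"
  have L3: "(\<lambda>n. of_nat n * (S n - 1 - \<i> * of_real (\<tau> * e n))) \<longlonglongrightarrow> of_real (- \<tau>\<^sup>2 / 2)"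
    using LIMSEQ_iexp_second_order[of \<tau>] by (simp add: S_def e_def)
  have Slim: "S \<longlonglongrightarrow> 1"
  proof -
    have "isCont (\<lambda>e. exp (\<i> * of_real \<tau> * e) :: complex) 0" by (intro continuous_intros)
    from filterlim_compose[OF this[unfolded isCont_def] e_lim] show ?thesis by (simp add: S_def)
  qed
  have L4: "(\<lambda>n. of_real (sqrt (1 - t\<^sup>2)) / csqrt (1 - (T * S n)\<^sup>2)) \<longlonglongrightarrow> 1"
  proof -
    have t2: "1 - t\<^sup>2 > 0" using t by (simp add: power_less_one_iff)
    have "1 - (T * 1)\<^sup>2 = of_real (1 - t\<^sup>2)" by (simp add: T_def)
    hence "csqrt (1 - (T * 1)\<^sup>2) = of_real (sqrt (1 - t\<^sup>2))" and np: "1 - (T * 1)\<^sup>2 \<notin> \<real>\<^sub>\<le>\<^sub>0"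
      using t2 csqrt_of_real_nonneg[of "1 - t\<^sup>2"] by (auto simp del: of_real_diff)
    moreover have "(\<lambda>n. of_real (sqrt (1 - t\<^sup>2)) / csqrt (1 - (T * S n)\<^sup>2)) \<longlonglongrightarrow>
        of_real (sqrt (1 - t\<^sup>2)) / csqrt (1 - (T * 1)\<^sup>2)"
    proof (intro tendsto_divide tendsto_const)
      have "(\<lambda>n. 1 - (T * S n)\<^sup>2) \<longlonglongrightarrow> 1 - (T * 1)\<^sup>2"
        by (intro tendsto_intros Slim)
      with np show "(\<lambda>n. csqrt (1 - (T * S n)\<^sup>2)) \<longlonglongrightarrow> csqrt (1 - (T * 1)\<^sup>2)"
        using isCont_tendsto_compose continuous_at_csqrt by blast
      show "csqrt (1 - (T * 1)\<^sup>2) \<noteq> 0" using np by auto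
    qed
    ultimately show ?thesis using t2 by simp
  qed
  \<comment> \<open>The exponent \<open>n (S - 1) H - \<i> \<tau> sqrt n\<close> is regrouped, using
    \<open>n e = 1 / e = sqrt n\<close>, so that each piece converges separately although the two
    original terms diverge.\<close>
  have "(\<lambda>n. of_real (sqrt (1 - t\<^sup>2)) / csqrt (1 - (T * S n)\<^sup>2) *
      exp (of_nat n * (S n - 1 - \<i> * of_real (\<tau> * e n)) * H (of_real (e n))
           + \<i> * of_real \<tau> * ((H (of_real (e n)) - 1) / of_real (e n))))
      \<longlonglongrightarrow> 1 * exp (of_real (- \<tau>\<^sup>2 / 2) * 1 + \<i> * of_real \<tau> * H')"
    by (intro tendsto_intros L1 L2 L3 L4)
  also have "1 * exp (of_real (- \<tau>\<^sup>2 / 2) * 1 + \<i> * of_real \<tau> * H') =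
      exp (\<i> * of_real (\<tau> * \<mu>) - of_real (\<tau>\<^sup>2 * (1 + 2 * v) / 2))"
    by (simp add: H'_def algebra_simps power2_eq_square add_divide_distrib)
  finally show ?thesis
  proof (rule Lim_transform_eventually)
    show "\<forall>\<^sub>F n in sequentially. of_real (sqrt (1 - t\<^sup>2)) / csqrt (1 - (T * S n)\<^sup>2) *
      exp (of_nat n * (S n - 1 - \<i> * of_real (\<tau> * e n)) * H (of_real (e n))
           + \<i> * of_real \<tau> * ((H (of_real (e n)) - 1) / of_real (e n))) =
      edge_gf t n (Complex x y + b / of_real (sqrt (real n))) (exp (\<i> * of_real (\<tau> / sqrt (real n))))
            * exp (- \<i> * of_real (\<tau> * sqrt (real n)))"
      using eventually_gt_at_top[of 0]
    proof eventually_elim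
      case (elim n)
      define E where "E = complex_of_real (e n)"
      have E: "E \<noteq> 0" "of_nat n * E = 1 / E"
      proof -
        show "E \<noteq> 0" using elim by (simp add: E_def e_def)
        have "real n * e n = 1 / e n" using elim by (simp add: e_def real_div_sqrt)
        thus "of_nat n * E = 1 / E"
          unfolding E_def by (metis of_real_1 of_real_divide of_real_mult of_real_of_nat_eq)
      qed
      have z: "Re (Complex x y + b / of_real (sqrt (real n))) = x + Re b * e n"
              "Im (Complex x y + b / of_real (sqrt (real n))) = y + Im b * e n"
        by (simp_all add: e_def Re_divide_of_real Im_divide_of_real)
      have S: "exp (\<i> * of_real (\<tau> / sqrt (real n))) = S n"
        by (simp add: S_def e_def)
      have H: "of_real ((x + Re b * e n)\<^sup>2 * (1 - t)) / (1 + of_real t * S n)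
             + of_real ((y + Im b * e n)\<^sup>2 * (1 + t)) / (1 - of_real t * S n) = H E"
        by (simp add: H_def X_def Y_def D1_def D2_def T_def S_def E_def)
      have sq: "\<i> * of_real (\<tau> * sqrt (real n)) = \<i> * of_real \<tau> * (1 / E)"
        using elim by (simp add: E_def e_def)
      have "of_nat n * (S n - 1 - \<i> * of_real (\<tau> * e n)) * H E + \<i> * of_real \<tau> * ((H E - 1) / E) =
          of_nat n * ((S n - 1) * H E) - \<i> * of_real \<tau> * (of_nat n * E) * H E
            + \<i> * of_real \<tau> * (1 / E) * H E - \<i> * of_real \<tau> * (1 / E)"
        by (simp add: E_def[symmetric] diff_divide_distrib algebra_simps)
      also have "\<dots> = of_nat n * ((S n - 1) * H E) + (- \<i> * of_real (\<tau> * sqrt (real n)))"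
        unfolding E(2) using sq by simp
      finally have eq: "of_nat n * (S n - 1 - \<i> * of_real (\<tau> * e n)) * H E + \<i> * of_real \<tau> * ((H E - 1) / E) =
          of_nat n * ((S n - 1) * H E) + (- \<i> * of_real (\<tau> * sqrt (real n)))" .
      show ?case
        unfolding edge_gf_def z S H unfolding E_def[symmetric] T_def[symmetric] eq exp_add
        by (simp only: mult.assoc)
    qed
  qed
qed

theorem corollary7p7:
  fixes t \<phi> \<psi> :: real and z0 a :: complex
  assumes "0 < t" and "t < 1"
    and "- pi < \<phi>" and "\<phi> \<le> pi"
    and "z0 = of_real (semi_axis_re t * cos \<phi>) + \<i> * of_real (semi_axis_im t * sin \<phi>)"
    and "z0 \<in> ellipse_boundary t"
    and "\<psi> = normal_angle t \<phi>"
  shows "(\<lambda>n. eigenvalue_density (elliptic_potential t) n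
             (z0 + a * exp (\<i> * of_real \<psi>) / of_real (sqrt (real n))))
         \<longlonglongrightarrow> 1 / (2 * pi) * erfc (sqrt 2 * Re a)"
proof -
  note t = assms(1,2)
  define A where "A = sqrt ((1 - t) / (1 + t)) * cos \<phi>"
  define B where "B = sqrt ((1 + t) / (1 - t)) * sin \<phi>"
  define \<sigma> where "\<sigma> = sqrt (A\<^sup>2 + B\<^sup>2)"
  have \<sigma>: "\<sigma> > 0" "\<sigma> * cos \<psi> = A" "\<sigma> * sin \<psi> = B"
    unfolding \<sigma>_def A_def B_def assms(7) by (fact normal_angle_cos_sin[OF assms(1-4)])+
  define x where "x = sqrt ((1 + t) / (1 - t)) * cos \<phi>"
  define y where "y = sqrt ((1 - t) / (1 + t)) * sin \<phi>"
  have z0: "z0 = Complex x y"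
    unfolding assms(5) by (simp add: x_def y_def semi_axis_re_def semi_axis_im_def complex_eq_iff)
  have x2: "x\<^sup>2 = (1 + t) / (1 - t) * (cos \<phi>)\<^sup>2" and y2: "y\<^sup>2 = (1 - t) / (1 + t) * (sin \<phi>)\<^sup>2"
    and A2: "A\<^sup>2 = (1 - t) / (1 + t) * (cos \<phi>)\<^sup>2" and B2: "B\<^sup>2 = (1 + t) / (1 - t) * (sin \<phi>)\<^sup>2"
    using t by (simp_all add: x_def y_def A_def B_def power_mult_distrib)
  have ell: "x\<^sup>2 * (1 - t) / (1 + t) + y\<^sup>2 * (1 + t) / (1 - t) = 1"
    using t by (simp add: x2 y2)
  have sqrt_eq: "sqrt ((1 + t) / (1 - t)) * ((1 - t) / (1 + t)) = sqrt ((1 - t) / (1 + t))"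
    "sqrt ((1 - t) / (1 + t)) * ((1 + t) / (1 - t)) = sqrt ((1 + t) / (1 - t))"
    using t sqrt_divide_self_eq[of "(1 + t) / (1 - t)"] sqrt_divide_self_eq[of "(1 - t) / (1 + t)"]
    by (simp_all flip: real_sqrt_inverse)
  have xA: "x * ((1 - t) / (1 + t)) = A"
    using arg_cong[OF sqrt_eq(1), of "\<lambda>u. u * cos \<phi>"] by (simp only: x_def A_def mult_ac)
  have yB: "y * ((1 + t) / (1 - t)) = B"
    using arg_cong[OF sqrt_eq(2), of "\<lambda>u. u * sin \<phi>"] by (simp only: y_def B_def mult_ac)
  define b where "b = a * exp (\<i> * of_real \<psi>)"
  define v where "v = y\<^sup>2 * (1 + t) * t / (1 - t)\<^sup>2 - x\<^sup>2 * (1 - t) * t / (1 + t)\<^sup>2"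
  define \<mu> where "\<mu> = 2 * x * Re b * (1 - t) / (1 + t) + 2 * y * Im b * (1 + t) / (1 - t)"
  \<comment> \<open>The variance constant is the squared length of the normal vector; replacing 1 by
    the sum of the squares of cosine and sine makes this visible.\<close>
  have v: "1 + 2 * v = \<sigma>\<^sup>2"
  proof -
    have "v = t / (1 - t) * (sin \<phi>)\<^sup>2 - t / (1 + t) * (cos \<phi>)\<^sup>2"
      using t unfolding v_def x2 y2 by (simp add: power2_eq_square mult_ac)
    hence "1 + 2 * v = ((cos \<phi>)\<^sup>2 + (sin \<phi>)\<^sup>2) + 2 * (t / (1 - t) * (sin \<phi>)\<^sup>2 - t / (1 + t) * (cos \<phi>)\<^sup>2)"
      by simp
    also have "\<dots> = (1 - t) / (1 + t) * (cos \<phi>)\<^sup>2 + (1 + t) / (1 - t) * (sin \<phi>)\<^sup>2"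
    proof -
      have "(1 - t) / (1 + t) = 1 - 2 * (t / (1 + t))" "(1 + t) / (1 - t) = 1 + 2 * (t / (1 - t))"
        using t by (simp_all add: field_simps)
      thus ?thesis by (simp only: ring_distribs)
    qed
    also have "\<dots> = \<sigma>\<^sup>2" unfolding A2[symmetric] B2[symmetric] \<sigma>_def by simp
    finally show ?thesis .
  qed
  \<comment> \<open>\<mu> is the inner product of the gradient, which is 2\<sigma> times the unit
    normal, with the displacement \<open>b\<close>. Rotation by \<psi> makes Re a the normal
    component, and the tangential one drops out.\<close>
  have \<mu>: "\<mu> = \<sigma> * (2 * Re a)"
  proof -
    have b: "Re b = Re a * cos \<psi> - Im a * sin \<psi>" "Im b = Re a * sin \<psi> + Im a * cos \<psi>"
      by (simp_all add: b_def exp_Euler cos_of_real sin_of_real)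
    have "\<mu> = 2 * (x * ((1 - t) / (1 + t)) * Re b + y * ((1 + t) / (1 - t)) * Im b)"
      by (simp add: \<mu>_def algebra_simps)
    also have "\<dots> = 2 * \<sigma> * (cos \<psi> * Re b + sin \<psi> * Im b)"
      unfolding xA yB \<sigma>(2,3)[symmetric] by (simp add: algebra_simps)
    also have "cos \<psi> * Re b + sin \<psi> * Im b = Re a * ((cos \<psi>)\<^sup>2 + (sin \<psi>)\<^sup>2)"
      unfolding b by algebra
    finally show ?thesis by simp
  qed
  define m where "m = 2 * Re a"
  define z where "z = (\<lambda>n. z0 + b / of_real (sqrt (real n)))"
  \<comment> \<open>Subtracting m as well makes the limit the standard normal law; the cut-off moves
    to -m accordingly.\<close>
  define Y where "Y = (\<lambda>n k. (real k - real n) / (\<sigma> * sqrt (real n)) - m)"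
  define M where "M = (\<lambda>n. distr (measure_pmf (edge_pmf t n (z n))) borel (Y n))"
  \<comment> \<open>Levy's theorem asks for this at every index. At \<open>n = 0\<close> the weights
    do not sum to 1, but \<open>edge_pmf\<close> is still some probability mass function.\<close>
  have distM: "real_distribution (M n)" for n
    unfolding M_def by (rule prob_space.real_distribution_distr[OF prob_space_measure_pmf]) simp
  interpret N: real_distribution std_normal_distribution
    by (rule real_dist_normal_dist)
  have char: "char (M n) \<theta> =
      edge_gf t n (z n) (exp (\<i> * of_real (\<theta> / \<sigma> / sqrt (real n)))) *
        exp (- \<i> * of_real (\<theta> / \<sigma> * sqrt (real n))) * exp (- \<i> * of_real (\<theta> * m))"
    if n: "n > 0" for n \<theta>
  proof -
    let ?s = "exp (\<i> * of_real (\<theta> / \<sigma> / sqrt (real n))) :: complex"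
    let ?C = "exp (- \<i> * of_real (\<theta> / \<sigma> * sqrt (real n))) * exp (- \<i> * of_real (\<theta> * m)) :: complex"
    have s: "norm ?s \<le> 1" by simp
    have ch: "char (M n) \<theta> = (\<integral>k. iexp (\<theta> * Y n k) \<partial>measure_pmf (edge_pmf t n (z n)))"
      unfolding char_def M_def by (subst integral_distr) auto
    have sums: "(\<lambda>k. of_real (pmf (edge_pmf t n (z n)) k) * iexp (\<theta> * Y n k)) sums
        (\<integral>k. iexp (\<theta> * Y n k) \<partial>measure_pmf (edge_pmf t n (z n)))"
      by (rule pmf_nat_sums_integral[where B = 1]) simp
    have terms: "(\<lambda>k. of_real (pmf (edge_pmf t n (z n)) k) * iexp (\<theta> * Y n k)) =
        (\<lambda>k. of_real (edge_weight t n (z n) k) * ?s ^ k * ?C)"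
    proof
      fix k
      have "\<theta> * Y n k = real k * (\<theta> / \<sigma> / sqrt (real n)) - \<theta> / \<sigma> * sqrt (real n) - \<theta> * m"
        using \<sigma>(1) n by (simp add: Y_def field_simps)
      hence "iexp (\<theta> * Y n k) = exp (of_nat k * (\<i> * of_real (\<theta> / \<sigma> / sqrt (real n)))
          + (- \<i> * of_real (\<theta> / \<sigma> * sqrt (real n))) + (- \<i> * of_real (\<theta> * m)))"
        by (simp only:) (simp add: algebra_simps)
      also have "\<dots> = ?s ^ k * ?C"
        by (simp only: exp_add exp_of_nat_mult mult.assoc)
      finally show "of_real (pmf (edge_pmf t n (z n)) k) * iexp (\<theta> * Y n k) =
          of_real (edge_weight t n (z n) k) * ?s ^ k * ?C"
        by (simp only: pmf_edge_pmf[OF t n] mult.assoc)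
    qed
    have "(\<lambda>k. of_real (edge_weight t n (z n) k) * ?s ^ k * ?C) sums (edge_gf t n (z n) ?s * ?C)"
      by (intro sums_mult2 edge_weight_sums t n s)
    with sums[unfolded terms] have "(\<integral>k. iexp (\<theta> * Y n k) \<partial>measure_pmf (edge_pmf t n (z n))) =
        edge_gf t n (z n) ?s * ?C"
      by (rule sums_unique2)
    with ch show ?thesis by (simp only: mult.assoc)
  qed
  have "(\<lambda>n. char (M n) \<theta>) \<longlonglongrightarrow> char std_normal_distribution \<theta>" for \<theta>
  proof -
    have "(\<lambda>n. edge_gf t n (z n) (exp (\<i> * of_real (\<theta> / \<sigma> / sqrt (real n)))) *
        exp (- \<i> * of_real (\<theta> / \<sigma> * sqrt (real n))) * exp (- \<i> * of_real (\<theta> * m)))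
      \<longlonglongrightarrow> exp (\<i> * of_real (\<theta> / \<sigma> * \<mu>) - of_real ((\<theta> / \<sigma>)\<^sup>2 * (1 + 2 * v) / 2)) * exp (- \<i> * of_real (\<theta> * m))"
      unfolding z_def z0 v_def \<mu>_def by (intro tendsto_mult tendsto_const edge_gf_limit[OF t ell])
    also have "exp (\<i> * of_real (\<theta> / \<sigma> * \<mu>) - of_real ((\<theta> / \<sigma>)\<^sup>2 * (1 + 2 * v) / 2)) * exp (- \<i> * of_real (\<theta> * m))
        = char std_normal_distribution \<theta>"
    proof -
      have 1: "\<theta> / \<sigma> * \<mu> = \<theta> * m" and 2: "(\<theta> / \<sigma>)\<^sup>2 * (1 + 2 * v) / 2 = \<theta>\<^sup>2 / 2"
        using \<sigma>(1) by (simp_all add: \<mu> m_def v power_divide)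
      show ?thesis
        unfolding 1 2 char_std_normal_distribution exp_of_real[symmetric]
        by (simp flip: exp_add)
    qed
    finally show ?thesis
      by (rule Lim_transform_eventually)
         (use eventually_gt_at_top[of 0] in eventually_elim, simp only: char)
  qed
  hence weak: "weak_conv_m M std_normal_distribution"
    by (rule levy_continuity[OF distM N.real_distribution_axioms])
  \<comment> \<open>Weak convergence controls only sets whose boundary is null for the limit law;
    here the boundary is one point and the limit has a density.\<close>
  have null: "emeasure std_normal_distribution (frontier {..<- m}) = 0"
  proof -
    have "frontier {..<- m} = {- m}" by simp
    moreover have "{- m} \<in> null_sets std_normal_distribution"
    proof -
      have "AE u in lborel. u \<in> {- m} \<longrightarrow> ennreal (std_normal_density u) = 0"
        using AE_lborel_singleton[of "- m"] by (rule eventually_mono) simp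
      thus ?thesis by (subst null_sets_density_iff) simp_all
    qed
    ultimately show ?thesis by (simp add: null_sets_def)
  qed
  have "(\<lambda>n. measure (M n) {..<- m}) \<longlonglongrightarrow> measure std_normal_distribution {..<- m}"
    by (rule weak_conv_imp_continuity_set_conv[OF distM N.real_distribution_axioms weak])
       (use null in auto)
  hence "(\<lambda>n. measure (M n) {..<- m} / pi) \<longlonglongrightarrow> erfc (sqrt 2 * Re a) / 2 / pi"
    unfolding m_def std_normal_distribution_lessThan by (intro tendsto_intros) auto
  also have "erfc (sqrt 2 * Re a) / 2 / pi = 1 / (2 * pi) * erfc (sqrt 2 * Re a)" by simp
  finally show ?thesis
  proof (rule Lim_transform_eventually)
    show "\<forall>\<^sub>F n in sequentially. measure (M n) {..<- m} / pi =
      eigenvalue_density (elliptic_potential t) n (z0 + a * exp (\<i> * of_real \<psi>) / of_real (sqrt (real n)))"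
      using eventually_gt_at_top[of 0]
    proof eventually_elim
      case (elim n)
      \<comment> \<open>The shift by m cancels, so the strict inequality becomes
        \<open>k < n\<close>, the exact range of the truncated sum.\<close>
      have "Y n -` {..<- m} = {..<n}"
      proof -
        have "\<sigma> * sqrt (real n) > 0" using \<sigma>(1) elim by simp
        thus ?thesis by (auto simp: Y_def divide_less_0_iff)
      qed
      hence "measure (M n) {..<- m} = measure (measure_pmf (edge_pmf t n (z n))) {..<n}"
        unfolding M_def by (subst measure_distr) auto
      also have "\<dots> = (\<Sum>k<n. edge_weight t n (z n) k)"
        by (simp add: measure_measure_pmf_finite pmf_edge_pmf[OF t elim])
      finally show ?case
        using eigenvalue_density_eq[OF t elim, of "z n"] by (simp add: z_def b_def)
    qed
  qed
qed

end
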